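(* Let $M = M(S; F(I), G(\Lambda); P)$ be a Rees matrix semigroup (without zero) over a semigroupoid $S$. If $M$ is prefix-automatic then $S$ is prefix-automatic.
   Context: Semigroupoids. A (directed) graph $X$ has a set $X^0$ of vertices, a set $X^1$ of edges, and source and target maps $\alpha,\omega: X^1\to X^0$. A semigroupoid $S$ is a small graph (vertices are called objects, edges are called arrows) with a partial multiplication on arrows such that $ef$ is defined if and only if $\omega(e)=\alpha(f)$, in which case $\alpha(ef)=\alpha(e)$ and $\omega(ef)=\omega(f)$, and $e(fg)=(ef)g$ whenever $ef$ and $fg$ are defined. (Thus a semigroupoid is a small category without the requirement of identities.) We write $s\in S$ for $s\in S^1$. $S$ is isolation-free if every object is the source or target of some arrow. A semigroup is regarded as a semigroupoid with one object. Paths and regularity. For a graph $X$, $X^+$ is the free semigroupoid on $X$: its objects are $X^0$, its arrows are the non-empty paths $e_1\cdots e_n$ with $\omega(e_i)=\alpha(e_{i+1})$. All graphs over which regularity is considered are finite. A language $L\subseteq X^+$ is regular if it is regular in the usual sense as a set of words over the alphabet $X^1$ (equivalently, it is accepted by a finite automaton labelled by the graph $X$). Let $X^{\$}$ be $X$ with one extra loop $\$_s$ at each vertex $s$. For $(a,b)\in X^+\times X^+$, let $\delta_X(a,b)\in (X^{\$}\times X^{\$})^+$ be the path obtained by padding the shorter of $a,b$ on the right with copies of $\$_t$, where $t$ is the target of that shorter path, to the length of the longer one, and reading the two paths as a single path of pairs of edges. A relation $R\subseteq X^+\times X^+$ is synchronously regular if $\delta_X(R)$ is a regular language (over the edges of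 $X^{\$}\times X^{\$}$). Automaticity. A choice of representatives for a semigroupoid $S$ is a triple $(X,K,\rho)$ where $X$ is a graph with $X^0=S^0$, $\rho:X^+\to S$ is a surjective semigroupoid morphism that is the identity on objects, and $K\subseteq X^+$ satisfies $\rho(K)=S^1$. It is finitely generated if $X$ has finitely many edges. An automatic structure for $S$ is a finitely generated choice of representatives $(X,K,\rho)$ such that the relation $K_a=\{(u,v)\in K\times K : \omega(u)=\alpha(a),\ \rho(ua)=\rho(v)\}$ is synchronously regular for each edge $a\in X^1$, and the relation $K_a=\{(u,v)\in K\times K: \omega(u)=a,\ \rho(u)=\rho(v)\}$ is synchronously regular for each vertex $a\in X^0$ (regarded as an empty path). A prefix-automatic structure is an automatic structure $(X,K,\rho)$ such that moreover $K'_= = \{(u,v)\in K\times \mathrm{Pref}(K): \rho(u)=\rho(v)\}$ is synchronously regular, where $\mathrm{Pref}(K)$ is the set of non-empty prefixes of paths in $K$. $S$ is prefix-automatic if it admits a prefix-automatic structure. Rees matrix semigroups without zero. Let $S$ be a non-empty isolation-free semigroupoid, $I,\Lambda$ index sets, $F:I\to\alpha(S^1)$ and $G:\Lambda\to\omega(S^1)$ surjective functions, and $P$ a $\Lambda\times I$ matrix with entries in $S^1$ (no zero entries) such that $\alpha(P_{\lambda i})=G(\lambda)$ and $\omega(P_{\lambda i})=F(i)$ for all $\lambda\in\Lambda$, $i\in I$. The Rees matrix semigroup (without zero) $M(S;F(I),G(\Lambda);P)$ (the notation $F(I),G(\Lambda)$ is purely symbolic) has elements $\{(i,x,\lambda)\in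 I\times S\times\Lambda : F(i)=\alpha(x),\ \omega(x)=G(\lambda)\}$, with multiplication $(i,x,\lambda)(j,y,\mu)=(i,xP_{\lambda j}y,\mu)$. *)

theory Defs
  imports "Graph_Theory.Arc_Walk" "HOL-Library.Sublist"
begin

section \<open>Semigroupoids\<close>

text \<open>
  Graphs (multiple arcs and loops allowed) are those of the \<^locale>\<open>wf_digraph\<close> locale; the source
  and target maps are \<^const>\<open>tail\<close> and \<^const>\<open>head\<close>. The partial multiplication is a total
  function whose value at \<open>e\<close>, \<open>f\<close> matters only for arrows with \<open>head S e = tail S f\<close>.
\<close>

locale semigroupoid = wf_digraph S
  for S :: "('o, 'a) pre_digraph" +
  fixes mult :: "'a \<Rightarrow> 'a \<Rightarrow> 'a" (infixl \<open>\<cdot>\<close> 70)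
  assumes mult_closed: "\<lbrakk>e \<in> arcs S; f \<in> arcs S; head S e = tail S f\<rbrakk> \<Longrightarrow> e \<cdot> f \<in> arcs S"
    and tail_mult: "\<lbrakk>e \<in> arcs S; f \<in> arcs S; head S e = tail S f\<rbrakk> \<Longrightarrow> tail S (e \<cdot> f) = tail S e"
    and head_mult: "\<lbrakk>e \<in> arcs S; f \<in> arcs S; head S e = tail S f\<rbrakk> \<Longrightarrow> head S (e \<cdot> f) = head S f"
    and mult_assoc: "\<lbrakk>e \<in> arcs S; f \<in> arcs S; g \<in> arcs S; head S e = tail S f; head S f = tail S g\<rbrakk>
      \<Longrightarrow> e \<cdot> (f \<cdot> g) = (e \<cdot> f) \<cdot> g"

definition isolation_free :: "('o, 'a) pre_digraph \<Rightarrow> bool" where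
  "isolation_free S \<longleftrightarrow> (\<forall>v\<in>verts S. \<exists>e\<in>arcs S. tail S e = v \<or> head S e = v)"

text \<open>Morphisms that are the identity on objects.\<close>

definition object_fixing_morphism ::
  "('o, 'a) pre_digraph \<Rightarrow> ('a \<Rightarrow> 'a \<Rightarrow> 'a) \<Rightarrow> ('o, 'b) pre_digraph \<Rightarrow> ('b \<Rightarrow> 'b \<Rightarrow> 'b) \<Rightarrow>
    ('a \<Rightarrow> 'b) \<Rightarrow> bool" where
  "object_fixing_morphism S mS T mT \<rho> \<longleftrightarrow>
     verts S = verts T \<and>
     (\<forall>e\<in>arcs S. \<rho> e \<in> arcs T \<and> tail T (\<rho> e) = tail S e \<and> head T (\<rho> e) = head S e) \<and>
     (\<forall>e\<in>arcs S. \<forall>f\<in>arcs S. head S e = tail S f \<longrightarrow> \<rho> (mS e f) = mT (\<rho> e) (\<rho> f))"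


section \<open>Paths and regularity\<close>

definition paths :: "('v, 'e) pre_digraph \<Rightarrow> 'e list set" where
  "paths X = {p. p \<noteq> [] \<and> (\<exists>u v. pre_digraph.awalk X u p v)}"

text \<open>The underlying graph of the free semigroupoid; its multiplication is concatenation.\<close>

definition path_graph :: "('v, 'e) pre_digraph \<Rightarrow> ('v, 'e list) pre_digraph" where
  "path_graph X = \<lparr>verts = verts X, arcs = paths X,
     tail = (\<lambda>p. tail X (hd p)), head = (\<lambda>p. head X (last p))\<rparr>"

text \<open>
  Regular languages over a finite alphabet \<open>A\<close>, via complete deterministic automata. Every finite
  state set can be renamed to a set of natural numbers, so fixing the type of states is harmless.
\<close>

definition regular_language :: "'c set \<Rightarrow> 'c list set \<Rightarrow> bool" where
  "regular_language A L \<longleftrightarrow> finite A \<and>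
     (\<exists>(Q :: nat set) q\<^sub>0 F \<delta>. finite Q \<and> q\<^sub>0 \<in> Q \<and> F \<subseteq> Q \<and> (\<forall>q\<in>Q. \<forall>a\<in>A. \<delta> q a \<in> Q) \<and>
        L = {w \<in> lists A. foldl \<delta> q\<^sub>0 w \<in> F})"

datatype ('v, 'e) dollar_edge = Edge 'e | Dollar 'v

definition dollar_graph :: "('v, 'e) pre_digraph \<Rightarrow> ('v, ('v, 'e) dollar_edge) pre_digraph" where
  "dollar_graph X = \<lparr>verts = verts X, arcs = Edge ` arcs X \<union> Dollar ` verts X,
     tail = (\<lambda>e. case e of Edge e \<Rightarrow> tail X e | Dollar v \<Rightarrow> v),
     head = (\<lambda>e. case e of Edge e \<Rightarrow> head X e | Dollar v \<Rightarrow> v)\<rparr>"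

definition prod_graph ::
  "('v, 'e) pre_digraph \<Rightarrow> ('w, 'f) pre_digraph \<Rightarrow> ('v \<times> 'w, 'e \<times> 'f) pre_digraph" where
  "prod_graph X Y = \<lparr>verts = verts X \<times> verts Y, arcs = arcs X \<times> arcs Y,
     tail = map_prod (tail X) (tail Y), head = map_prod (head X) (head Y)\<rparr>"

definition pad_path :: "('v, 'e) pre_digraph \<Rightarrow> nat \<Rightarrow> 'e list \<Rightarrow> ('v, 'e) dollar_edge list" where
  "pad_path X n p = map Edge p @ replicate (n - length p) (Dollar (head X (last p)))"

definition pad_pair ::
  "('v, 'e) pre_digraph \<Rightarrow> 'e list \<times> 'e list \<Rightarrow> (('v, 'e) dollar_edge \<times> ('v, 'e) dollar_edge) list" where
  "pad_pair X = (\<lambda>(a, b).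
     let n = max (length a) (length b) in zip (pad_path X n a) (pad_path X n b))"

definition synchronously_regular ::
  "('v, 'e) pre_digraph \<Rightarrow> ('e list \<times> 'e list) set \<Rightarrow> bool" where
  "synchronously_regular X R \<longleftrightarrow> R \<subseteq> paths X \<times> paths X \<and>
     regular_language (arcs (prod_graph (dollar_graph X) (dollar_graph X))) (pad_pair X ` R)"


section \<open>Automaticity\<close>

definition choice_of_representatives ::
  "('o, 'a) pre_digraph \<Rightarrow> ('a \<Rightarrow> 'a \<Rightarrow> 'a) \<Rightarrow>
    ('o, 'e) pre_digraph \<Rightarrow> 'e list set \<Rightarrow> ('e list \<Rightarrow> 'a) \<Rightarrow> bool" where
  "choice_of_representatives S mult X K \<rho> \<longleftrightarrow>
     wf_digraph X \<and>
     object_fixing_morphism (path_graph X) (@) S mult \<rho> \<and> \<rho> ` paths X = arcs S \<and>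
     K \<subseteq> paths X \<and> \<rho> ` K = arcs S"

definition edge_relation ::
  "('v, 'e) pre_digraph \<Rightarrow> 'e list set \<Rightarrow> ('e list \<Rightarrow> 'a) \<Rightarrow> 'e \<Rightarrow> ('e list \<times> 'e list) set" where
  "edge_relation X K \<rho> a =
     {(u, v) \<in> K \<times> K. head X (last u) = tail X a \<and> \<rho> (u @ [a]) = \<rho> v}"

definition vertex_relation ::
  "('v, 'e) pre_digraph \<Rightarrow> 'e list set \<Rightarrow> ('e list \<Rightarrow> 'a) \<Rightarrow> 'v \<Rightarrow> ('e list \<times> 'e list) set" where
  "vertex_relation X K \<rho> a = {(u, v) \<in> K \<times> K. head X (last u) = a \<and> \<rho> u = \<rho> v}"

definition automatic_structure ::
  "('o, 'a) pre_digraph \<Rightarrow> ('a \<Rightarrow> 'a \<Rightarrow> 'a) \<Rightarrow>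
    ('o, 'e) pre_digraph \<Rightarrow> 'e list set \<Rightarrow> ('e list \<Rightarrow> 'a) \<Rightarrow> bool" where
  "automatic_structure S mult X K \<rho> \<longleftrightarrow>
     choice_of_representatives S mult X K \<rho> \<and> finite (arcs X) \<and>
     (\<forall>a\<in>arcs X. synchronously_regular X (edge_relation X K \<rho> a)) \<and>
     (\<forall>a\<in>verts X. synchronously_regular X (vertex_relation X K \<rho> a))"

definition Pref :: "'e list set \<Rightarrow> 'e list set" where
  "Pref K = {p. p \<noteq> [] \<and> (\<exists>w\<in>K. prefix p w)}"

definition prefix_automatic_structure ::
  "('o, 'a) pre_digraph \<Rightarrow> ('a \<Rightarrow> 'a \<Rightarrow> 'a) \<Rightarrow>
    ('o, 'e) pre_digraph \<Rightarrow> 'e list set \<Rightarrow> ('e list \<Rightarrow> 'a) \<Rightarrow> bool" where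
  "prefix_automatic_structure S mult X K \<rho> \<longleftrightarrow>
     automatic_structure S mult X K \<rho> \<and>
     synchronously_regular X {(u, v) \<in> K \<times> Pref K. \<rho> u = \<rho> v}"

text \<open>
  The generating graph has finitely many edges, which can be named by natural numbers; its vertices
  are the objects of \<open>S\<close>.
\<close>

definition prefix_automatic :: "('o, 'a) pre_digraph \<Rightarrow> ('a \<Rightarrow> 'a \<Rightarrow> 'a) \<Rightarrow> bool" where
  "prefix_automatic S mult \<longleftrightarrow>
     (\<exists>(X :: ('o, nat) pre_digraph) K \<rho>. prefix_automatic_structure S mult X K \<rho>)"


section \<open>Rees matrix semigroups without zero\<close>

locale rees_matrix_data = semigroupoid S mult
  for S :: "('o, 'a) pre_digraph" and mult :: "'a \<Rightarrow> 'a \<Rightarrow> 'a" (infixl \<open>\<cdot>\<close> 70) +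
  fixes I :: "'i set" and \<Lambda> :: "'l set"
    and F :: "'i \<Rightarrow> 'o" and G :: "'l \<Rightarrow> 'o" and P :: "'l \<Rightarrow> 'i \<Rightarrow> 'a"
  assumes nonempty: "verts S \<noteq> {}"
    and isolation_free: "isolation_free S"
    and F_surj: "F ` I = tail S ` arcs S"
    and G_surj: "G ` \<Lambda> = head S ` arcs S"
    and P_arc: "\<lbrakk>l \<in> \<Lambda>; i \<in> I\<rbrakk> \<Longrightarrow> P l i \<in> arcs S"
    and tail_P: "\<lbrakk>l \<in> \<Lambda>; i \<in> I\<rbrakk> \<Longrightarrow> tail S (P l i) = G l"
    and head_P: "\<lbrakk>l \<in> \<Lambda>; i \<in> I\<rbrakk> \<Longrightarrow> head S (P l i) = F i"

text \<open>A semigroup is a semigroupoid whose only object is \<open>()\<close>; its arrows are its elements.\<close>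

definition semigroup_graph :: "'b set \<Rightarrow> (unit, 'b) pre_digraph" where
  "semigroup_graph M = \<lparr>verts = {()}, arcs = M, tail = (\<lambda>_. ()), head = (\<lambda>_. ())\<rparr>"

definition rees_carrier ::
  "('o, 'a) pre_digraph \<Rightarrow> 'i set \<Rightarrow> 'l set \<Rightarrow> ('i \<Rightarrow> 'o) \<Rightarrow> ('l \<Rightarrow> 'o) \<Rightarrow> ('i \<times> 'a \<times> 'l) set" where
  "rees_carrier S I \<Lambda> F G =
     {(i, x, l) \<in> I \<times> arcs S \<times> \<Lambda>. F i = tail S x \<and> head S x = G l}"

definition rees_mult ::
  "('a \<Rightarrow> 'a \<Rightarrow> 'a) \<Rightarrow> ('l \<Rightarrow> 'i \<Rightarrow> 'a) \<Rightarrow> 'i \<times> 'a \<times> 'l \<Rightarrow> 'i \<times> 'a \<times> 'l \<Rightarrow> 'i \<times> 'a \<times> 'l" where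
  "rees_mult mult P = (\<lambda>(i, x, l) (j, y, m). (i, mult (mult x (P l j)) y, m))"

lemma (in rees_matrix_data) semigroupoid_rees:
  "semigroupoid (semigroup_graph (rees_carrier S I \<Lambda> F G)) (rees_mult mult P)"
proof
qed (auto simp: semigroup_graph_def rees_carrier_def rees_mult_def mult_closed tail_mult head_mult
      P_arc tail_P head_P mult_assoc)

lemma semigroupoid_path_graph:
  assumes "wf_digraph X"
  shows "semigroupoid (path_graph X) (@)"
proof -
  interpret wf_digraph X by fact
  have tl: "tail X (hd p) = u \<and> head X (last p) = v" if "awalk u p v" "p \<noteq> []" for u p v
    using that by (auto simp: awalk_conv awalk_verts_conv hd_map)
  have ends: "awalk (tail X (hd p)) p (head X (last p))" if "p \<in> paths X" for p
    using that tl by (auto simp: paths_def)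
  have app: "p @ q \<in> paths X"
    if "p \<in> paths X" "q \<in> paths X" "head X (last p) = tail X (hd q)" for p q
  proof -
    have "awalk (tail X (hd p)) (p @ q) (head X (last q))"
      using ends[OF that(1)] ends[OF that(2)] that(3) by (metis awalk_appendI)
    then show ?thesis
      using that(1) unfolding paths_def by blast
  qed
  have ne: "p \<noteq> []" if "p \<in> paths X" for p
    using that by (simp add: paths_def)
  show ?thesis
  proof
    fix e assume "e \<in> arcs (path_graph X)"
    then have "e \<noteq> []" "set e \<subseteq> arcs X"
      by (auto simp: path_graph_def paths_def awalk_def)
    then have "hd e \<in> arcs X" "last e \<in> arcs X" by auto
    then show "tail (path_graph X) e \<in> verts (path_graph X)" "head (path_graph X) e \<in> verts (path_graph X)"
      by (simp_all add: path_graph_def)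
  qed (use app ne in \<open>auto simp: path_graph_def\<close>)
qed

end

theory Submission
  imports Defs
begin

text \<open>The obstacle is that \<open>S\<close> need not have identities, while every product in
  \<open>M\<close> inserts an entry of \<open>P\<close>. Right multiplication of a representative by
  an edge in \<open>S\<close> is therefore not a right multiplication in \<open>M\<close>: the
  inserted entry cannot be cancelled. Instead the last letter is removed and the remaining prefix is
  multiplied in \<open>M\<close> by an element that carries the desired arrow and has the row index
  of the removed letter, so that the entry of \<open>P\<close> in between stays the same. The
  remaining prefix need not lie in \<open>K\<close>; the relation between \<open>K\<close> and
  \<open>Pref K\<close> supplies a representative of equal value, to which the edge relations of
  \<open>M\<close> apply. Fixing the outer indices makes equality of arrows in \<open>S\<close>
  agree with equality in \<open>M\<close>; otherwise one arrow could occur under several pairs of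
  indices.\<close>

text \<open>
  Words over the generators of the Rees matrix semigroup \<open>M\<close> are turned into paths over \<open>S\<close> of the same
  length: a generator \<open>(i, s, l)\<close> followed by one with row index \<open>j\<close> becomes an arrow of value
  \<open>s \<cdot> P l j\<close>. The representatives for \<open>S\<close> are the paths arising from representatives for \<open>M\<close> whose
  outer indices are chosen once and for all at every object. Changing only the last letter of a prefix
  of a representative is an operation on \<open>M\<close> that is regular by prefix-automaticity, and the relations
  required for \<open>S\<close> are finite unions of preimages of such operations. Regularity is handled through
  finiteness of the set of residuals (Myhill--Nerode), for relations as for languages.
\<close>

section \<open>Regular languages through residuals\<close>

definition residual :: "'c list set \<Rightarrow> 'c list \<Rightarrow> 'c list set" where
  "residual L w = {s. w @ s \<in> L}"

text \<open>All words of the type count, not only those over an alphabet, so that closure properties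
  can be stated without one.\<close>

definition finite_residuals :: "'c list set \<Rightarrow> bool" where
  "finite_residuals L \<longleftrightarrow> finite (range (residual L))"

lemma in_residual [simp]: "s \<in> residual L w \<longleftrightarrow> w @ s \<in> L"
  by (simp add: residual_def)

lemma residual_append: "residual L (v @ w) = residual (residual L v) w"
  by (simp add: residual_def)

text \<open>The scheme of most finiteness proofs below: the residual at \<open>x\<close> is a
  function \<open>h\<close> of data with finitely many values.\<close>

lemma finite_range_factor:
  assumes "finite B" "\<And>x. \<exists>b\<in>B. f x = h b"
  shows "finite (range f)"
  by (rule finite_subset[of _ "h ` B"]) (use assms in auto)

lemma finite_residuals_if_regular:
  assumes "regular_language A L"
  shows "finite_residuals L"
proof -
  obtain Q :: "nat set" and q F \<delta> where fin: "finite Q" and q: "q \<in> Q"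
    and \<delta>: "\<forall>q\<in>Q. \<forall>a\<in>A. \<delta> q a \<in> Q" and L: "L = {w \<in> lists A. foldl \<delta> q w \<in> F}"
    using assms unfolding regular_language_def by auto
  have run: "foldl \<delta> p w \<in> Q" if "p \<in> Q" "w \<in> lists A" for p w
    using that(2,1) by (induction w arbitrary: p) (use \<delta> in auto)
  \<comment> \<open>\<open>None\<close> is a sink for words that contain a letter outside
    \<open>A\<close>.\<close>
  define h where "h = (\<lambda>x. case x of None \<Rightarrow> {} | Some p \<Rightarrow> {s \<in> lists A. foldl \<delta> p s \<in> F})"
  show ?thesis
    unfolding finite_residuals_def
  proof (rule finite_range_factor[of "insert None (Some ` Q)" _ h])
    fix w
    show "\<exists>b\<in>insert None (Some ` Q). residual L w = h b"
    proof (cases "w \<in> lists A")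
      case True
      then have "residual L w = h (Some (foldl \<delta> q w))"
        by (auto simp: L h_def)
      then show ?thesis using run[OF q True] by blast
    next
      case False
      then have "residual L w = h None" by (auto simp: L h_def)
      then show ?thesis by blast
    qed
  qed (use fin in simp)
qed

lemma regular_if_finite_residuals:
  assumes "finite A" "L \<subseteq> lists A" "finite_residuals L"
  shows "regular_language A L"
proof -
  let ?R = "range (residual L)"
  have fin: "finite ?R" using assms(3) by (simp add: finite_residuals_def)
  obtain f :: "'a list set \<Rightarrow> nat" where inj: "inj_on f ?R"
    using fin by (meson finite_imp_inj_to_nat_seg)
  define st where "st w = f (residual L w)" for w
  \<comment> \<open>States are codes of residuals; \<open>inv_into\<close> decodes a state so that
    the letter \<open>a\<close> can act on it as a further quotient.\<close>
  define \<delta> where "\<delta> q a = f (residual (inv_into ?R f q) [a])" for q a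
  have step: "\<delta> (st w) a = st (w @ [a])" for w a
    unfolding \<delta>_def st_def using inj by (simp add: residual_append)
  have run: "foldl \<delta> (st []) w = st w" for w
    by (induction w rule: rev_induct) (simp_all add: step)
  \<comment> \<open>Acceptance can be read off the residual: \<open>w\<close> lies in
    \<open>L\<close> iff \<open>[]\<close> lies in \<open>residual L w\<close>.\<close>
  have acc: "st w \<in> st ` L \<longleftrightarrow> w \<in> L" for w
  proof
    assume "st w \<in> st ` L"
    then obtain v where "v \<in> L" "residual L w = residual L v"
      using inj by (auto simp: st_def inj_on_eq_iff)
    then show "w \<in> L" using in_residual[of "[]" L] by (metis append_Nil2)
  qed auto
  have "st ` L \<subseteq> f ` ?R" "st [] \<in> f ` ?R" "\<forall>q\<in>f ` ?R. \<forall>a\<in>A. \<delta> q a \<in> f ` ?R"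
    using step by (auto simp: st_def)
  moreover have "L = {w \<in> lists A. foldl \<delta> (st []) w \<in> st ` L}"
    using assms(2) by (auto simp: run acc)
  ultimately show ?thesis
    unfolding regular_language_def using assms(1) fin by blast
qed

section \<open>Closure properties of languages with finitely many residuals\<close>

lemma finite_residuals_Int:
  assumes "finite_residuals L" "finite_residuals M"
  shows "finite_residuals (L \<inter> M)"
  unfolding finite_residuals_def
  by (rule finite_range_factor[of "range (residual L) \<times> range (residual M)" _ "\<lambda>(a, b). a \<inter> b"])
    (use assms in \<open>auto simp: finite_residuals_def residual_def\<close>)

lemma finite_residuals_vimage_map:
  assumes "finite_residuals L"
  shows "finite_residuals {x. map f x \<in> L}"
  unfolding finite_residuals_def
  by (rule finite_range_factor[of "range (residual L)" _ "\<lambda>M. {x. map f x \<in> M}"])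
    (use assms in \<open>auto simp: finite_residuals_def\<close>)

text \<open>The Boolean records whether \<open>w\<close> is empty: \<open>Pref\<close> omits the
  empty prefix, and this affects the residual only at \<open>w = []\<close>.\<close>

lemma finite_residuals_Pref:
  assumes "finite_residuals L"
  shows "finite_residuals (Pref L)"
  unfolding finite_residuals_def
proof (rule finite_range_factor[where
      h = "\<lambda>(M, b). {p. (b \<longrightarrow> p \<noteq> []) \<and> (\<exists>w\<in>M. prefix p w)}"])
  fix w
  show "\<exists>x\<in>range (residual L) \<times> UNIV. residual (Pref L) w =
      (case x of (M, b) \<Rightarrow> {p. (b \<longrightarrow> p \<noteq> []) \<and> (\<exists>w\<in>M. prefix p w)})"
    by (rule bexI[of _ "(residual L w, w = [])"]) (auto simp: Pref_def prefix_def residual_def)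
qed (use assms in \<open>simp add: finite_residuals_def\<close>)

lemma finite_residuals_last: "finite_residuals {x. x \<noteq> [] \<and> last x = c}"
  unfolding finite_residuals_def
proof (rule finite_range_factor[where h = "\<lambda>b. {s. if s = [] then b else last s = c}"])
  fix w
  show "\<exists>b\<in>UNIV. residual {x. x \<noteq> [] \<and> last x = c} w = {s. if s = [] then b else last s = c}"
    by (rule bexI[of _ "w \<noteq> [] \<and> last w = c"]) (auto simp: last_append)
qed simp

text \<open>After a non-empty word that still has a continuation only its last letter matters. This
  leaves one residual for each letter of \<open>E\<close>, besides \<open>{}\<close> and the
  language itself.\<close>

lemma finite_residuals_local:
  assumes "finite E"
  shows "finite_residuals
    {x. x \<noteq> [] \<and> set x \<subseteq> E \<and> p (hd x) \<and> successively r x \<and> q (last x)}" (is "finite_residuals ?L")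
  unfolding finite_residuals_def
proof (rule finite_subset)
  let ?res = "\<lambda>e. {s. set s \<subseteq> E \<and> successively r (e # s) \<and> q (last (e # s))}"
  show "range (residual ?L) \<subseteq> {?L, {}} \<union> ?res ` E"
  proof (rule image_subsetI)
    fix w
    show "residual ?L w \<in> {?L, {}} \<union> ?res ` E"
    proof (cases "w = [] \<or> residual ?L w = {}")
      case True
      then show ?thesis by (auto simp: residual_def)
    next
      case False
      then obtain v e where w: "w = v @ [e]" by (metis rev_exhaust)
      have link: "successively r (v @ e # t) \<longleftrightarrow> successively r w \<and> successively r (e # t)" for t
        unfolding w successively_append_iff by auto
      have mem: "t \<in> residual ?L w \<longleftrightarrow>
          set w \<subseteq> E \<and> p (hd w) \<and> successively r w \<and> t \<in> ?res e" for t
        using link[of t] w by (cases v) auto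
      from False obtain s where "s \<in> residual ?L w" by blast
      then have w': "set w \<subseteq> E" "p (hd w)" "successively r w" unfolding mem by simp_all
      have "residual ?L w = ?res e" by (rule set_eqI) (simp only: mem w' simp_thms)
      moreover have "e \<in> E" using w w'(1) by simp
      ultimately show ?thesis by blast
    qed
  qed
qed (use assms in simp)


section \<open>Synchronously regular relations through residuals\<close>

text \<open>
  The padded form of a pair reaching \<open>(u, v)\<close> can only be continued in a component that has not
  ended yet.
\<close>

definition continuations :: "'c list \<Rightarrow> 'd list \<Rightarrow> ('c list \<times> 'd list) set" where
  "continuations u v =
     {(s, t). (length u < length v \<longrightarrow> s = []) \<and> (length v < length u \<longrightarrow> t = [])}"

text \<open>The restriction to \<open>continuations\<close> is essential for finiteness: for the
  identity relation, the unrestricted quotient at \<open>(u, u @ w)\<close> consists of all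
  \<open>(w @ t, t)\<close> and is different for every \<open>w\<close>.\<close>

definition rel_residual ::
  "('c list \<times> 'd list) set \<Rightarrow> 'c list \<times> 'd list \<Rightarrow> ('c list \<times> 'd list) set" where
  "rel_residual R = (\<lambda>(u, v). {(s, t). (u @ s, v @ t) \<in> R} \<inter> continuations u v)"

definition finite_rel_residuals :: "('c list \<times> 'd list) set \<Rightarrow> bool" where
  "finite_rel_residuals R \<longleftrightarrow> finite (range (rel_residual R))"

lemma in_rel_residual [simp]:
  "(s, t) \<in> rel_residual R (u, v) \<longleftrightarrow> (u @ s, v @ t) \<in> R \<and> (s, t) \<in> continuations u v"
  by (simp add: rel_residual_def)

lemma in_continuations:
  "(s, t) \<in> continuations u v \<longleftrightarrow>
     (length u < length v \<longrightarrow> s = []) \<and> (length v < length u \<longrightarrow> t = [])"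
  by (simp add: continuations_def)

section \<open>Closure properties of relations with finitely many residuals\<close>

lemma finite_continuations: "finite (range (\<lambda>(u, v). continuations u v))"
proof (rule finite_range_factor[where
      h = "\<lambda>(a, b). {(s, t). (a \<longrightarrow> s = []) \<and> (b \<longrightarrow> t = [])}"])
  fix x :: "'c list \<times> 'd list"
  show "\<exists>y\<in>UNIV. (case x of (u, v) \<Rightarrow> continuations u v) =
      (case y of (a, b) \<Rightarrow> {(s, t). (a \<longrightarrow> s = []) \<and> (b \<longrightarrow> t = [])})"
    by (rule bexI[of _ "(length (fst x) < length (snd x), length (snd x) < length (fst x))"])
      (auto simp: continuations_def split: prod.splits)
qed simp

lemma rel_residual_Un: "rel_residual (R \<union> T) x = rel_residual R x \<union> rel_residual T x"
  by (auto simp: rel_residual_def)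

lemma rel_residual_Int: "rel_residual (R \<inter> T) x = rel_residual R x \<inter> rel_residual T x"
  by (auto simp: rel_residual_def)

lemma rel_residual_converse: "rel_residual (R\<inverse>) (u, v) = (rel_residual R (v, u))\<inverse>"
  by (auto simp: in_continuations)

lemma finite_rel_residuals_empty: "finite_rel_residuals {}"
  unfolding finite_rel_residuals_def rel_residual_def by simp

lemma finite_rel_residuals_Un:
  assumes "finite_rel_residuals R" "finite_rel_residuals T"
  shows "finite_rel_residuals (R \<union> T)"
  unfolding finite_rel_residuals_def
  by (rule finite_range_factor[of "range (rel_residual R) \<times> range (rel_residual T)" _
        "\<lambda>(a, b). a \<union> b"])
    (use assms rel_residual_Un[of R T] in \<open>auto simp: finite_rel_residuals_def\<close>)

lemma finite_rel_residuals_UN: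
  assumes "finite C" "\<And>c. c \<in> C \<Longrightarrow> finite_rel_residuals (R c)"
  shows "finite_rel_residuals (\<Union>c\<in>C. R c)"
  using assms
  by (induction C) (simp_all add: finite_rel_residuals_empty finite_rel_residuals_Un)

lemma finite_rel_residuals_Int:
  assumes "finite_rel_residuals R" "finite_rel_residuals T"
  shows "finite_rel_residuals (R \<inter> T)"
  unfolding finite_rel_residuals_def
  by (rule finite_range_factor[of "range (rel_residual R) \<times> range (rel_residual T)" _
        "\<lambda>(a, b). a \<inter> b"])
    (use assms rel_residual_Int[of R T] in \<open>auto simp: finite_rel_residuals_def\<close>)

lemma finite_rel_residuals_converse:
  assumes "finite_rel_residuals R"
  shows "finite_rel_residuals (R\<inverse>)"
  unfolding finite_rel_residuals_def
  by (rule finite_range_factor[of "range (rel_residual R)" _ converse])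
    (use assms in \<open>simp add: finite_rel_residuals_def\<close>, metis rangeI rel_residual_converse surj_pair)

lemma finite_rel_residuals_Times:
  fixes L :: "'c list set" and M :: "'d list set"
  assumes "finite_residuals L" "finite_residuals M"
  shows "finite_rel_residuals (L \<times> M)"
  unfolding finite_rel_residuals_def
proof (rule finite_range_factor[where h = "\<lambda>(a, b, c). (a \<times> b) \<inter> c"])
  fix x :: "'c list \<times> 'd list"
  obtain u v where x: "x = (u, v)" by force
  show "\<exists>y \<in> range (residual L) \<times> range (residual M) \<times> range (\<lambda>(u, v). continuations u v).
      rel_residual (L \<times> M) x = (case y of (a, b, c) \<Rightarrow> (a \<times> b) \<inter> c)"
    unfolding x
    by (rule bexI[of _ "(residual L u, residual M v, continuations u v)"]) auto
qed (use assms finite_continuations in \<open>auto simp: finite_residuals_def intro!: finite_cartesian_product\<close>)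

lemma finite_rel_residuals_vimage_map:
  fixes f :: "'b \<Rightarrow> 'd" and g :: "'c \<Rightarrow> 'e"
  assumes "finite_rel_residuals R"
  shows "finite_rel_residuals {(x, y). (map f x, map g y) \<in> R}"
  unfolding finite_rel_residuals_def
proof (rule finite_range_factor[where h = "\<lambda>T. {(x, y). (map f x, map g y) \<in> T}"])
  fix x :: "'b list \<times> 'c list"
  obtain u v where x: "x = (u, v)" by force
  show "\<exists>T \<in> range (rel_residual R).
      rel_residual {(x, y). (map f x, map g y) \<in> R} x = {(x, y). (map f x, map g y) \<in> T}"
    unfolding x
    by (rule bexI[of _ "rel_residual R (map f u, map g v)"]) (auto simp: in_continuations)
qed (use assms in \<open>simp add: finite_rel_residuals_def\<close>)

text \<open>
  A residual of \<open>R O T\<close> at \<open>(u, v)\<close> only depends on the set of pairs of residuals of \<open>R\<close> at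
  \<open>(u, w)\<close> and of \<open>T\<close> at \<open>(w, v)\<close>, where \<open>w\<close> ranges over all words: an intermediate word can be cut
  at the length of the longer one of \<open>u\<close> and \<open>v\<close>.
\<close>

lemma finite_rel_residuals_comp:
  fixes R :: "('b list \<times> 'c list) set" and T :: "('c list \<times> 'd list) set"
  assumes "finite_rel_residuals R" "finite_rel_residuals T"
  shows "finite_rel_residuals (R O T)"
  unfolding finite_rel_residuals_def
proof (rule finite_range_factor[where h = "\<lambda>(W, c). (\<Union>(a, b)\<in>W. a O b) \<inter> c"])
  fix x :: "'b list \<times> 'd list"
  obtain u v where x: "x = (u, v)" by force
  define W where "W = range (\<lambda>w. (rel_residual R (u, w), rel_residual T (w, v)))"
  have "rel_residual (R O T) (u, v) \<subseteq> (\<Union>(a, b)\<in>W. a O b) \<inter> continuations u v"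
  proof clarify
    fix s t assume st: "(s, t) \<in> rel_residual (R O T) (u, v)"
    then obtain w where w: "(u @ s, w) \<in> R" "(w, v @ t) \<in> T" by auto
    define n where "n = max (length u) (length v)"
    have "(s, drop n w) \<in> rel_residual R (u, take n w)"
      "(drop n w, t) \<in> rel_residual T (take n w, v)"
      using w st by (auto simp: in_continuations n_def)
    then show "(s, t) \<in> (\<Union>(a, b)\<in>W. a O b) \<inter> continuations u v"
      using st unfolding W_def by fastforce
  qed
  moreover have "(\<Union>(a, b)\<in>W. a O b) \<inter> continuations u v \<subseteq> rel_residual (R O T) (u, v)"
    unfolding W_def by auto
  ultimately have "rel_residual (R O T) (u, v) = (\<Union>(a, b)\<in>W. a O b) \<inter> continuations u v"
    by blast
  then show "\<exists>y \<in> Pow (range (rel_residual R) \<times> range (rel_residual T)) \<times>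
        range (\<lambda>(u, v). continuations u v).
      rel_residual (R O T) x = (case y of (W, c) \<Rightarrow> (\<Union>(a, b)\<in>W. a O b) \<inter> c)"
    unfolding x by (intro bexI[of _ "(W, continuations u v)"]) (auto simp: W_def)
qed (use assms finite_continuations in
    \<open>auto simp: finite_rel_residuals_def intro!: finite_cartesian_product\<close>)

text \<open>While \<open>u\<close> is read, \<open>v\<close> is consumed at the same pace. The state
  is a residual of \<open>R\<close> together with the unread part of \<open>v\<close>, one of
  finitely many suffixes.\<close>

lemma finite_residuals_section:
  assumes "finite_rel_residuals R"
  shows "finite_residuals {u. (u, v) \<in> R}"
  unfolding finite_residuals_def
proof (rule finite_range_factor[where h = "\<lambda>(T, t). {s. (s, t) \<in> T}"])
  fix u
  have "residual {u. (u, v) \<in> R} u =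
      {s. (s, drop (length u) v) \<in> rel_residual R (u, take (length u) v)}"
    by (auto simp: in_continuations)
  moreover have "drop (length u) v \<in> set (suffixes v)"
    by (simp add: suffix_drop)
  ultimately show "\<exists>y \<in> range (rel_residual R) \<times> set (suffixes v).
      residual {u. (u, v) \<in> R} u = (case y of (T, t) \<Rightarrow> {s. (s, t) \<in> T})"
    by force
qed (use assms in \<open>simp add: finite_rel_residuals_def\<close>)

text \<open>Both tracks carry the same word, so their lengths never differ. Applied to equality of
  values on \<open>K\<close>, this yields regularity of \<open>K\<close> itself.\<close>

lemma finite_residuals_diagonal:
  assumes "finite_rel_residuals R"
  shows "finite_residuals {u. (u, u) \<in> R}"
  unfolding finite_residuals_def
proof (rule finite_range_factor[where h = "\<lambda>T. {s. (s, s) \<in> T}"])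
  fix u
  show "\<exists>T \<in> range (rel_residual R). residual {u. (u, u) \<in> R} u = {s. (s, s) \<in> T}"
    by (rule bexI[of _ "rel_residual R (u, u)"]) (auto simp: in_continuations)
qed (use assms in \<open>simp add: finite_rel_residuals_def\<close>)

text \<open>Three states suffice: the tracks agree so far, the second track is ahead by exactly the
  letter \<open>a\<close>, or the pair has failed.\<close>

lemma finite_rel_residuals_snoc: "finite_rel_residuals (range (\<lambda>u. (u, u @ [a])))"
  unfolding finite_rel_residuals_def
proof (rule finite_subset)
  let ?R = "range (\<lambda>u. (u, u @ [a]))"
  show "range (rel_residual ?R) \<subseteq> {{}, ?R, {([], [])}}"
  proof (rule image_subsetI, clarify)
    fix u v
    assume ne: "rel_residual ?R (u, v) \<noteq> {}" and R: "rel_residual ?R (u, v) \<noteq> ?R"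
    have mem: "(s, t) \<in> rel_residual ?R (u, v) \<longleftrightarrow> v @ t = u @ s @ [a] \<and> (s, t) \<in> continuations u v"
      for s t
      by (simp add: image_iff)
    have snoc: "(s, t) \<in> ?R \<longleftrightarrow> t = s @ [a]" for s t
      by (simp add: image_iff)
    from ne obtain x where "x \<in> rel_residual ?R (u, v)" by (auto simp only: ex_in_conv[symmetric])
    then obtain s t where "(s, t) \<in> rel_residual ?R (u, v)" by (cases x) simp
    then have st: "v @ t = u @ s @ [a]" "(s, t) \<in> continuations u v"
      unfolding mem by simp_all
    show "rel_residual ?R (u, v) = {([], [])}"
    proof (cases "length u = length v")
      case True
      with st(1) have "u = v" by simp
      then have "(s, t) \<in> rel_residual ?R (u, v) \<longleftrightarrow> (s, t) \<in> ?R" for s t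
        unfolding mem snoc by (simp add: in_continuations)
      then have "rel_residual ?R (u, v) = ?R" by (intro set_eqI) (simp only: split_paired_all)
      with R show ?thesis by contradiction
    next
      case False
      have len: "length v + length t = length u + length s + 1"
        using arg_cong[OF st(1), of length] by simp
      with False st(2) have less: "length u < length v"
        by (cases "length v < length u") (simp_all add: in_continuations)
      with st(2) have "s = []" by (simp add: in_continuations)
      moreover have "t = []" using \<open>s = []\<close> len less by (cases t) simp_all
      ultimately have "v = u @ [a]" using st(1) by simp
      then have "(s, t) \<in> rel_residual ?R (u, v) \<longleftrightarrow> s = [] \<and> t = []" for s t
        unfolding mem by (auto simp: in_continuations)
      then show ?thesis by (intro set_eqI) (simp add: split_paired_all)
    qed
  qed
qed simp

section \<open>Passage between padded words and residuals of relations\<close>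

text \<open>\<open>d\<close> and \<open>e\<close> are the vertices reached so far in the two components.\<close>

fun pad_from :: "('v, 'e) pre_digraph \<Rightarrow> 'v \<Rightarrow> 'v \<Rightarrow> 'e list \<Rightarrow> 'e list \<Rightarrow>
    (('v, 'e) dollar_edge \<times> ('v, 'e) dollar_edge) list" where
  "pad_from X d e [] [] = []"
| "pad_from X d e (x # s) (y # t) = (Edge x, Edge y) # pad_from X (head X x) (head X y) s t"
| "pad_from X d e [] (y # t) = (Dollar d, Edge y) # pad_from X d (head X y) [] t"
| "pad_from X d e (x # s) [] = (Edge x, Dollar e) # pad_from X (head X x) e s []"

lemma pad_from_eq_zip:
  "pad_from X d e u v =
     zip (map Edge u @ replicate (max (length u) (length v) - length u)
            (Dollar (if u = [] then d else head X (last u))))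
         (map Edge v @ replicate (max (length u) (length v) - length v)
            (Dollar (if v = [] then e else head X (last v))))"
  by (induction X d e u v rule: pad_from.induct) auto

text \<open>Both start vertices are replaced before any dollar is emitted, so they may be
  arbitrary.\<close>

lemma pad_pair_eq_pad_from:
  "u \<noteq> [] \<Longrightarrow> v \<noteq> [] \<Longrightarrow> pad_pair X (u, v) = pad_from X d e u v"
  by (simp add: pad_from_eq_zip pad_pair_def pad_path_def Let_def)

lemma pad_from_eq_ConsE:
  assumes "pad_from X d e p q = c # s"
  obtains x p' y q' where "p = x # p'" "q = y # q'" "c = (Edge x, Edge y)"
      "s = pad_from X (head X x) (head X y) p' q'"
    | y q' where "p = []" "q = y # q'" "c = (Dollar d, Edge y)" "s = pad_from X d (head X y) [] q'"
    | x p' where "p = x # p'" "q = []" "c = (Edge x, Dollar e)" "s = pad_from X (head X x) e p' []"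
  using assms by (cases p; cases q) auto

lemma mem_image_case_prod: "x \<in> case_prod f ` A \<longleftrightarrow> (\<exists>p q. (p, q) \<in> A \<and> f p q = x)"
  by (auto simp: image_iff) force+

text \<open>An automaton reading padded words has to remember a residual of \<open>R\<close> and the
  vertices reached on both tracks, since these determine the later dollars. Such a vertex is the
  initial one or the head of an arc, hence \<open>H\<close>.\<close>

lemma residual_pad_from:
  fixes R :: "('e list \<times> 'e list) set"
  assumes "R \<subseteq> lists (arcs X) \<times> lists (arcs X)"
  defines "H \<equiv> \<lambda>d. insert d (head X ` arcs X)"
  shows "residual (case_prod (pad_from X d e) ` R) w = {} \<or>
    (\<exists>u v. \<exists>d'\<in>H d. \<exists>e'\<in>H e.
       residual (case_prod (pad_from X d e) ` R) w = case_prod (pad_from X d' e') ` rel_residual R (u, v))"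
proof (induction w rule: rev_induct)
  case Nil
  have "residual (case_prod (pad_from X d e) ` R) [] = case_prod (pad_from X d e) ` rel_residual R ([], [])"
    by (auto simp: residual_def rel_residual_def continuations_def)
  then show ?case by (auto simp: H_def)
next
  case (snoc c w)
  let ?L = "case_prod (pad_from X d e) ` R"
  show ?case
  proof (cases "residual ?L (w @ [c]) = {}")
    case False
    then obtain s where s: "c # s \<in> residual ?L w"
      unfolding residual_append by (metis append_Cons append_Nil ex_in_conv in_residual)
    then have "residual ?L w \<noteq> {}" by (metis empty_iff)
    with snoc obtain u v d' e' where d: "d' \<in> H d" "e' \<in> H e"
      and L: "residual ?L w = case_prod (pad_from X d' e') ` rel_residual R (u, v)"
      by auto
    have L': "s \<in> residual ?L (w @ [c]) \<longleftrightarrow>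
        (\<exists>p q. (p, q) \<in> rel_residual R (u, v) \<and> pad_from X d' e' p q = c # s)" for s
      by (simp only: residual_append L in_residual mem_image_case_prod append_Cons append_Nil)
    from s obtain p q where pq: "(p, q) \<in> rel_residual R (u, v)" "pad_from X d' e' p q = c # s"
      unfolding L by force
    have arcs: "set p \<subseteq> arcs X" "set q \<subseteq> arcs X" using pq(1) assms(1) by auto
    \<comment> \<open>The shape of \<open>c\<close> tells which tracks go on. The pair
      \<open>p\<close>, \<open>q\<close> shows that \<open>(u, v)\<close> admits a continuation of
      this shape, so \<open>pq(1)\<close> supplies the comparison of lengths that
      \<open>continuations\<close> asks for.\<close>
    from pq(2) show ?thesis
    proof (cases rule: pad_from_eq_ConsE)
      case (1 x p' y q')
      have "residual ?L (w @ [c]) =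
          case_prod (pad_from X (head X x) (head X y)) ` rel_residual R (u @ [x], v @ [y])"
      proof (intro equalityI subsetI)
        fix s assume "s \<in> residual ?L (w @ [c])"
        then obtain p q where "(p, q) \<in> rel_residual R (u, v)" "pad_from X d' e' p q = c # s"
          unfolding L' by blast
        then show "s \<in> case_prod (pad_from X (head X x) (head X y)) ` rel_residual R (u @ [x], v @ [y])"
          by (auto elim!: pad_from_eq_ConsE simp: 1 in_continuations mem_image_case_prod)
      next
        fix s assume "s \<in> case_prod (pad_from X (head X x) (head X y)) ` rel_residual R (u @ [x], v @ [y])"
        then obtain p' q' where "(p', q') \<in> rel_residual R (u @ [x], v @ [y])"
          "s = pad_from X (head X x) (head X y) p' q'" by auto
        then show "s \<in> residual ?L (w @ [c])"
          unfolding L' using pq(1)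
          by (intro exI[of _ "x # p'"] exI[of _ "y # q'"]) (auto simp: 1 in_continuations)
      qed
      moreover have "head X x \<in> H d" "head X y \<in> H e" using arcs 1 by (auto simp: H_def)
      ultimately show ?thesis by blast
    next
      case (2 y q')
      have "residual ?L (w @ [c]) =
          case_prod (pad_from X d' (head X y)) ` rel_residual R (u, v @ [y])"
      proof (intro equalityI subsetI)
        fix s assume "s \<in> residual ?L (w @ [c])"
        then obtain p q where "(p, q) \<in> rel_residual R (u, v)" "pad_from X d' e' p q = c # s"
          unfolding L' by blast
        then show "s \<in> case_prod (pad_from X d' (head X y)) ` rel_residual R (u, v @ [y])"
          by (auto elim!: pad_from_eq_ConsE simp: 2 in_continuations mem_image_case_prod)
      next
        fix s assume "s \<in> case_prod (pad_from X d' (head X y)) ` rel_residual R (u, v @ [y])"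
        then obtain p' q' where "(p', q') \<in> rel_residual R (u, v @ [y])"
          "s = pad_from X d' (head X y) p' q'" by auto
        then show "s \<in> residual ?L (w @ [c])"
          unfolding L' using pq(1)
          by (intro exI[of _ "[]"] exI[of _ "y # q'"]) (auto simp: 2 in_continuations)
      qed
      moreover have "head X y \<in> H e" using arcs 2 by (auto simp: H_def)
      ultimately show ?thesis using d by blast
    next
      case (3 x p')
      have "residual ?L (w @ [c]) =
          case_prod (pad_from X (head X x) e') ` rel_residual R (u @ [x], v)"
      proof (intro equalityI subsetI)
        fix s assume "s \<in> residual ?L (w @ [c])"
        then obtain p q where "(p, q) \<in> rel_residual R (u, v)" "pad_from X d' e' p q = c # s"
          unfolding L' by blast
        then show "s \<in> case_prod (pad_from X (head X x) e') ` rel_residual R (u @ [x], v)"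
          by (auto elim!: pad_from_eq_ConsE simp: 3 in_continuations mem_image_case_prod)
      next
        fix s assume "s \<in> case_prod (pad_from X (head X x) e') ` rel_residual R (u @ [x], v)"
        then obtain p' q' where "(p', q') \<in> rel_residual R (u @ [x], v)"
          "s = pad_from X (head X x) e' p' q'" by auto
        then show "s \<in> residual ?L (w @ [c])"
          unfolding L' using pq(1)
          by (intro exI[of _ "x # p'"] exI[of _ "[]"]) (auto simp: 3 in_continuations)
      qed
      moreover have "head X x \<in> H d" using arcs 3 by (auto simp: H_def)
      ultimately show ?thesis using d by blast
    qed
  qed simp
qed

lemma paths_nonempty_lists: "p \<in> paths X \<Longrightarrow> p \<noteq> [] \<and> set p \<subseteq> arcs X"
  by (auto simp: paths_def pre_digraph.awalk_def)

lemma image_pad_pair: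
  assumes "R \<subseteq> paths X \<times> paths X"
  shows "pad_pair X ` R = case_prod (pad_from X d e) ` R"
proof (rule image_cong[OF refl], clarify)
  fix u v assume "(u, v) \<in> R"
  then have "u \<noteq> []" "v \<noteq> []" using assms by (auto dest: paths_nonempty_lists)
  then show "pad_pair X (u, v) = pad_from X d e u v" by (rule pad_pair_eq_pad_from)
qed

lemma pad_pair_in_lists:
  assumes "wf_digraph X" "u \<in> paths X" "v \<in> paths X"
  shows "pad_pair X (u, v) \<in> lists (arcs (prod_graph (dollar_graph X) (dollar_graph X)))"
proof -
  have arcs: "u \<noteq> [] \<and> set u \<subseteq> arcs X" "v \<noteq> [] \<and> set v \<subseteq> arcs X"
    using assms(2,3) by (auto dest: paths_nonempty_lists)
  then have "head X (last u) \<in> verts X" "head X (last v) \<in> verts X"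
    using wf_digraph.head_in_verts[OF assms(1)] last_in_set by blast+
  with arcs have "set (pad_path X n u) \<subseteq> arcs (dollar_graph X)"
    "set (pad_path X n v) \<subseteq> arcs (dollar_graph X)" for n
    by (auto simp: pad_path_def dollar_graph_def)
  then show ?thesis
    unfolding pad_pair_def prod_graph_def Let_def
    by (auto dest: set_zip_leftD set_zip_rightD; meson set_zip_leftD set_zip_rightD subsetD)
qed

lemma synchronously_regular_if_finite_rel_residuals:
  fixes X :: "('v, 'e) pre_digraph"
  assumes "wf_digraph X" "finite (verts X)" "finite (arcs X)" "R \<subseteq> paths X \<times> paths X"
    and "finite_rel_residuals R"
  shows "synchronously_regular X R"
proof -
  \<comment> \<open>Any start vertex serves: by \<open>image_pad_pair\<close> it does not affect the
    padded relation.\<close>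
  define d :: 'v where "d = undefined"
  define H where "H = insert d (head X ` arcs X)"
  let ?L = "case_prod (pad_from X d d) ` R"
  have L: "pad_pair X ` R = ?L"
    using assms(4) by (rule image_pad_pair)
  have "finite_residuals ?L"
    unfolding finite_residuals_def
  proof (rule finite_subset)
    have "R \<subseteq> lists (arcs X) \<times> lists (arcs X)"
      using assms(4) paths_nonempty_lists by blast
    note res = residual_pad_from[OF this, of d d, folded H_def]
    show "range (residual ?L) \<subseteq> insert {} (\<Union>d'\<in>H. \<Union>e'\<in>H.
        (\<lambda>T. case_prod (pad_from X d' e') ` T) ` range (rel_residual R))"
    proof (rule image_subsetI)
      fix w
      show "residual ?L w \<in> insert {} (\<Union>d'\<in>H. \<Union>e'\<in>H.
          (\<lambda>T. case_prod (pad_from X d' e') ` T) ` range (rel_residual R))"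
      proof (cases "residual ?L w = {}")
        case False
        with res[of w] obtain u v d' e' where de: "d' \<in> H" "e' \<in> H"
          and eq: "residual ?L w = case_prod (pad_from X d' e') ` rel_residual R (u, v)"
          by blast
        show ?thesis unfolding eq by (intro insertI2 UN_I[OF de(1)] UN_I[OF de(2)] imageI rangeI)
      qed simp
    qed
  qed (use assms in \<open>simp add: H_def finite_rel_residuals_def\<close>)
  moreover have "?L \<subseteq> lists (arcs (prod_graph (dollar_graph X) (dollar_graph X)))"
    using assms(4) pad_pair_in_lists[OF assms(1)] unfolding L[symmetric] by blast
  moreover have "finite (arcs (prod_graph (dollar_graph X) (dollar_graph X)))"
    using assms(2,3) by (simp add: prod_graph_def dollar_graph_def)
  ultimately show ?thesis
    using assms(4) regular_if_finite_residuals unfolding synchronously_regular_def L by blast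
qed

text \<open>Lets membership in a relation be read off the padded words, whatever vertices their
  dollars carry.\<close>

lemma pad_from_inject:
  "pad_from X d e u v = pad_from X d' e' u' v' \<Longrightarrow> u = u' \<and> v = v'"
proof (induction X d e u v arbitrary: d' e' u' v' rule: pad_from.induct)
  case (1 X d e)
  then show ?case by (cases u'; cases v') auto
next
  case (2 X d e x s y t)
  then show ?case by (cases u'; cases v') auto
next
  case (3 X d e y t)
  then show ?case by (cases u'; cases v') auto
next
  case (4 X d e x s)
  then show ?case by (cases u'; cases v') auto
qed

text \<open>The next two lemmas concern graphs with a single vertex, where all dollars are equal.\<close>

lemma pad_from_append:
  fixes X :: "(unit, 'e) pre_digraph"
  assumes "(s, t) \<in> continuations u v"
  shows "pad_from X () () (u @ s) (v @ t) = pad_from X () () u v @ pad_from X () () s t"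
  using assms
proof (induction X "()" "()" u v rule: pad_from.induct)
  case (3 X y t')
  then show ?case by (simp add: in_continuations)
next
  case (4 X x s')
  then show ?case by (simp add: in_continuations)
qed (auto simp: in_continuations)

lemma finite_rel_residuals_if_synchronously_regular:
  fixes X :: "(unit, 'e) pre_digraph"
  assumes "synchronously_regular X R"
  shows "finite_rel_residuals R"
proof -
  let ?pad = "pad_from X () ()"
  let ?L = "case_prod ?pad ` R"
  have R: "R \<subseteq> paths X \<times> paths X" using assms by (simp add: synchronously_regular_def)
  have "pad_pair X ` R = ?L"
    using R by (rule image_pad_pair)
  then have fin: "finite_residuals ?L"
    using assms finite_residuals_if_regular by (metis synchronously_regular_def)
  have in_L: "?pad u v \<in> ?L \<longleftrightarrow> (u, v) \<in> R" for u v
    by (force dest: pad_from_inject)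
  show ?thesis
    unfolding finite_rel_residuals_def
  proof (rule finite_range_factor[where h = "\<lambda>(M, c). {(s, t). ?pad s t \<in> M} \<inter> c"])
    fix x :: "'e list \<times> 'e list"
    obtain u v where x: "x = (u, v)" by force
    have "rel_residual R (u, v) =
        {(s, t). ?pad s t \<in> residual ?L (?pad u v)} \<inter> continuations u v"
      by (auto simp flip: pad_from_append in_L simp del: image_iff)
    then show "\<exists>y \<in> range (residual ?L) \<times> range (\<lambda>(u, v). continuations u v).
        rel_residual R x = (case y of (M, c) \<Rightarrow> {(s, t). ?pad s t \<in> M} \<inter> c)"
      unfolding x by (intro bexI[of _ "(residual ?L (?pad u v), continuations u v)"]) auto
  qed (use fin finite_continuations in
      \<open>auto simp: finite_residuals_def intro!: finite_cartesian_product\<close>)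
qed

section \<open>Prefix-automatic structures for semigroups\<close>

lemma (in wf_digraph) cas_conv_successively:
  "p \<noteq> [] \<Longrightarrow> cas u p v \<longleftrightarrow>
     tail G (hd p) = u \<and> successively (\<lambda>e f. head G e = tail G f) p \<and> head G (last p) = v"
proof (induction p arbitrary: u rule: list_nonempty_induct)
  case (cons e p)
  then show ?case
    unfolding cas.simps cons.IH successively_Cons by (simp add: eq_commute[of "head G e"] conj_ac)
qed simp

lemma paths_conv_successively:
  assumes "wf_digraph X"
  shows "paths X =
    {p. p \<noteq> [] \<and> set p \<subseteq> arcs X \<and> successively (\<lambda>e f. head X e = tail X f) p}"
proof -
  interpret wf_digraph X by fact
  show ?thesis
    unfolding paths_def awalk_def using cas_conv_successively
    by (auto intro!: tail_in_verts) (meson hd_in_set subsetD)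
qed

locale prefix_automatic_semigroup =
  fixes M :: "'m set" and mult :: "'m \<Rightarrow> 'm \<Rightarrow> 'm" (infixl \<open>\<odot>\<close> 70)
    and Y :: "(unit, 'e) pre_digraph" and K :: "'e list set" and \<rho> :: "'e list \<Rightarrow> 'm"
  assumes semigroupoid_M: "semigroupoid (semigroup_graph M) (\<odot>)"
    and structure_M: "prefix_automatic_structure (semigroup_graph M) (\<odot>) Y K \<rho>"
begin

lemma mult_in: "x \<in> M \<Longrightarrow> y \<in> M \<Longrightarrow> x \<odot> y \<in> M"
  using semigroupoid.mult_closed[OF semigroupoid_M] by (simp add: semigroup_graph_def)

lemma assoc: "x \<in> M \<Longrightarrow> y \<in> M \<Longrightarrow> z \<in> M \<Longrightarrow> x \<odot> (y \<odot> z) = x \<odot> y \<odot> z"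
  using semigroupoid.mult_assoc[OF semigroupoid_M] by (simp add: semigroup_graph_def)

lemma representatives_M: "choice_of_representatives (semigroup_graph M) (\<odot>) Y K \<rho>"
  using structure_M by (simp add: prefix_automatic_structure_def automatic_structure_def)

lemma finite_arcs_Y: "finite (arcs Y)"
  using structure_M by (simp add: prefix_automatic_structure_def automatic_structure_def)

lemma paths_Y: "paths Y = {p. p \<noteq> [] \<and> set p \<subseteq> arcs Y}"
  using representatives_M
  by (auto simp: choice_of_representatives_def paths_conv_successively intro: successively_if_sorted_wrt
      sorted_wrt_true)

lemma K_paths: "u \<in> K \<Longrightarrow> u \<noteq> [] \<and> set u \<subseteq> arcs Y"
  using representatives_M by (auto simp: choice_of_representatives_def paths_Y)

lemma rho_K: "\<rho> ` K = M"
  using representatives_M by (auto simp: choice_of_representatives_def semigroup_graph_def)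

lemma rho_in: "p \<noteq> [] \<Longrightarrow> set p \<subseteq> arcs Y \<Longrightarrow> \<rho> p \<in> M"
  using representatives_M
  by (auto simp: choice_of_representatives_def semigroup_graph_def paths_Y)

lemma rho_append:
  assumes "p \<noteq> []" "set p \<subseteq> arcs Y" "q \<noteq> []" "set q \<subseteq> arcs Y"
  shows "\<rho> (p @ q) = \<rho> p \<odot> \<rho> q"
  using representatives_M assms
  by (simp add: choice_of_representatives_def object_fixing_morphism_def semigroup_graph_def
      path_graph_def paths_Y)

text \<open>Left multiplication by the value of a word. The empty word acts as the identity map,
  which no element of the semigroup need do.\<close>

definition act :: "'e list \<Rightarrow> 'm \<Rightarrow> 'm" where
  "act = foldr (\<lambda>a. (\<odot>) (\<rho> [a]))"

lemma act_simps [simp]: "act [] t = t" "act (a # p) t = \<rho> [a] \<odot> act p t"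
  by (simp_all add: act_def)

lemma act_eq: "p \<noteq> [] \<Longrightarrow> set p \<subseteq> arcs Y \<Longrightarrow> t \<in> M \<Longrightarrow> act p t = \<rho> p \<odot> t"
proof (induction p rule: list_nonempty_induct)
  case (cons a p)
  then have "\<rho> (a # p) = \<rho> [a] \<odot> \<rho> p" using rho_append[of "[a]" p] by simp
  with cons show ?case by (simp add: assoc rho_in)
qed simp

lemma rho_eq_act: "p \<noteq> [] \<Longrightarrow> set p \<subseteq> arcs Y \<Longrightarrow> \<rho> p = act (butlast p) (\<rho> [last p])"
proof (cases "butlast p = []")
  case False
  assume p: "p \<noteq> []" "set p \<subseteq> arcs Y"
  then have b: "set (butlast p) \<subseteq> arcs Y" "last p \<in> arcs Y"
    by (auto dest: in_set_butlastD)
  then have "\<rho> (butlast p @ [last p]) = \<rho> (butlast p) \<odot> \<rho> [last p]"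
    using False by (intro rho_append) auto
  then show ?thesis using p b False by (simp add: act_eq rho_in)
next
  case True
  assume "p \<noteq> []"
  with True have "p = [last p]" by (metis append_butlast_last_id append_Nil)
  with True show ?thesis by (metis act_simps(1))
qed

lemma finite_rel_residuals_vertex: "finite_rel_residuals {(u, v) \<in> K \<times> K. \<rho> u = \<rho> v}"
proof -
  have "verts Y = {()}"
    using representatives_M
    by (simp add: choice_of_representatives_def object_fixing_morphism_def semigroup_graph_def
        path_graph_def)
  then have "synchronously_regular Y (vertex_relation Y K \<rho> ())"
    using structure_M by (simp add: prefix_automatic_structure_def automatic_structure_def)
  then show ?thesis
    using finite_rel_residuals_if_synchronously_regular by (simp add: vertex_relation_def)
qed

lemma finite_residuals_K: "finite_residuals K"
  using finite_residuals_diagonal[OF finite_rel_residuals_vertex] by simp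

lemma finite_rel_residuals_edge:
  assumes "a \<in> arcs Y"
  shows "finite_rel_residuals {(u, v) \<in> K \<times> K. \<rho> u \<odot> \<rho> [a] = \<rho> v}"
proof -
  have "synchronously_regular Y (edge_relation Y K \<rho> a)"
    using structure_M assms by (simp add: prefix_automatic_structure_def automatic_structure_def)
  moreover have "edge_relation Y K \<rho> a = {(u, v) \<in> K \<times> K. \<rho> u \<odot> \<rho> [a] = \<rho> v}"
    using K_paths rho_append[of _ "[a]"] assms by (auto simp: edge_relation_def)
  ultimately show ?thesis
    using finite_rel_residuals_if_synchronously_regular by metis
qed

text \<open>The edge relations of the letters of \<open>w\<close> are composed; \<open>ex\<close>
  provides the intermediate representative, as \<open>K\<close> represents every element.\<close>

lemma finite_rel_residuals_right_mult:
  assumes "w \<noteq> []" "set w \<subseteq> arcs Y"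
  shows "finite_rel_residuals {(u, v) \<in> K \<times> K. \<rho> u \<odot> \<rho> w = \<rho> v}"
  using assms
proof (induction w rule: rev_nonempty_induct)
  case (single a)
  then show ?case using finite_rel_residuals_edge by simp
next
  case (snoc a w)
  have eq: "\<rho> u \<odot> \<rho> (w @ [a]) = \<rho> u \<odot> \<rho> w \<odot> \<rho> [a]" if "u \<in> K" for u
    using snoc K_paths[OF that] rho_append[of w "[a]"] by (simp add: assoc rho_in)
  have ex: "\<exists>v\<in>K. \<rho> v = \<rho> u \<odot> \<rho> w" if "u \<in> K" for u
  proof -
    have "\<rho> u \<odot> \<rho> w \<in> \<rho> ` K"
      unfolding rho_K using snoc K_paths[OF that] by (intro mult_in rho_in) auto
    then show ?thesis by (metis imageE)
  qed
  have comp: "{(u, v) \<in> K \<times> K. \<rho> u \<odot> \<rho> (w @ [a]) = \<rho> v} =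
      {(u, v) \<in> K \<times> K. \<rho> u \<odot> \<rho> w = \<rho> v} O {(u, v) \<in> K \<times> K. \<rho> u \<odot> \<rho> [a] = \<rho> v}"
    using eq ex by fastforce
  show ?case
    unfolding comp using snoc by (intro finite_rel_residuals_comp finite_rel_residuals_edge) auto
qed

lemma finite_rel_residuals_prefix: "finite_rel_residuals {(u, v) \<in> K \<times> Pref K. \<rho> u = \<rho> v}"
  using structure_M finite_rel_residuals_if_synchronously_regular
  by (auto simp: prefix_automatic_structure_def)

text \<open>This is where prefix-automaticity enters. The last letter \<open>a\<close> of
  \<open>p\<close> is replaced by \<open>t\<close>. If \<open>p = [a]\<close>, the value is
  \<open>t\<close> itself (\<open>?A\<close>). Otherwise \<open>butlast p\<close> is a prefix whose
  value has a representative in \<open>K\<close>, and multiplying that by \<open>t\<close> on the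
  right leads to \<open>u\<close> (\<open>?B\<close>).\<close>

lemma finite_rel_residuals_act:
  assumes "t \<in> M" "a \<in> arcs Y"
  shows "finite_rel_residuals
    {(u, p). u \<in> K \<and> p \<in> Pref K \<and> last p = a \<and> \<rho> u = act (butlast p) t}" (is "finite_rel_residuals ?R")
proof -
  \<comment> \<open>A word for \<open>t\<close> turns multiplication by \<open>t\<close> into
    multiplication by generators.\<close>
  obtain w where w: "w \<in> K" "\<rho> w = t" using assms rho_K by blast
  let ?A = "{u. (u, w) \<in> {(u, v) \<in> K \<times> K. \<rho> u = \<rho> v}} \<times> {[a]}"
  let ?B = "({(u, v) \<in> K \<times> K. \<rho> u \<odot> \<rho> w = \<rho> v}\<inverse> O {(u, v) \<in> K \<times> Pref K. \<rho> u = \<rho> v}) O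
    range (\<lambda>u. (u, u @ [a]))"
  have Pref: "p \<noteq> [] \<and> set p \<subseteq> arcs Y" if "p \<in> Pref K" for p
    using that K_paths by (auto simp: Pref_def dest!: set_mono_prefix)
  have B: "(u, p) \<in> ?B \<longleftrightarrow> u \<in> K \<and> (\<exists>q. p = q @ [a] \<and> q \<in> Pref K \<and> \<rho> u = \<rho> q \<odot> t)" for u p
  proof -
    have "\<exists>v\<in>K. \<rho> v = \<rho> q" if "q \<in> Pref K" for q
      using Pref[OF that] rho_in rho_K by (metis imageE)
    then show ?thesis using w by (fastforce simp: relcomp_unfold)
  qed
  have "(u, p) \<in> ?R \<longleftrightarrow> (u, p) \<in> (?A \<union> ?B) \<inter> K \<times> Pref K" for u p
  proof
    assume "(u, p) \<in> ?R"
    then have up: "u \<in> K" "p \<in> Pref K" "\<rho> u = act (butlast p) t" "a = last p" by auto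
    show "(u, p) \<in> (?A \<union> ?B) \<inter> K \<times> Pref K"
    proof (cases "butlast p = []")
      case True
      then have "p = [a]" using Pref[OF up(2)] up(4) by (metis append_butlast_last_id append_Nil)
      then have "(u, p) \<in> ?A" using up(1,3) w by simp
      then show ?thesis using up(1,2) by blast
    next
      case False
      have "butlast p \<in> Pref K"
        using up(2) False by (auto simp: Pref_def dest: prefix_order.trans[OF prefixeq_butlast])
      then have "(u, p) \<in> ?B"
        unfolding B using up assms Pref False by (metis act_eq append_butlast_last_id)
      then show ?thesis using up(1,2) by blast
    qed
  next
    assume "(u, p) \<in> (?A \<union> ?B) \<inter> K \<times> Pref K"
    then have up: "(u, p) \<in> ?A \<union> ?B" "u \<in> K" "p \<in> Pref K" by auto
    from up(1) show "(u, p) \<in> ?R"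
    proof
      assume "(u, p) \<in> ?A"
      then show ?thesis using up w by simp
    next
      assume "(u, p) \<in> ?B"
      then show ?thesis using up Pref assms unfolding B by (auto simp: act_eq)
    qed
  qed
  then have R: "?R = (?A \<union> ?B) \<inter> K \<times> Pref K" by (intro set_eqI) (simp only: split_paired_all)
  \<comment> \<open>The singleton is a local language in which no letter may follow another.\<close>
  have fin: "finite_residuals {[a]}"
  proof -
    have "x \<noteq> [] \<and> set x \<subseteq> {a} \<and> True \<and> successively (\<lambda>_ _. False) x \<and> True \<longleftrightarrow> x = [a]" for x
      by (induction x rule: induct_list012) auto
    then show ?thesis
      using finite_residuals_local[of "{a}" "\<lambda>_. True" "\<lambda>_ _. False" "\<lambda>_. True"]
      by (simp only: singleton_conv finite.intros simp_thms)
  qed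
  show ?thesis
    unfolding R using K_paths[OF w(1)] fin
    by (intro finite_rel_residuals_Int finite_rel_residuals_Un finite_rel_residuals_Times
        finite_rel_residuals_comp finite_rel_residuals_converse finite_rel_residuals_snoc
        finite_residuals_section finite_rel_residuals_vertex finite_rel_residuals_right_mult
        finite_rel_residuals_prefix finite_residuals_Pref finite_residuals_K; blast)
qed

end

section \<open>From a Rees matrix semigroup to its base semigroupoid\<close>

locale prefix_automatic_rees = rees_matrix_data S mult I \<Lambda> F G P
  for S :: "('o, 'a) pre_digraph" and mult (infixl \<open>\<cdot>\<close> 70)
    and I :: "'i set" and \<Lambda> :: "'l set" and F G P +
  fixes Y :: "(unit, nat) pre_digraph" and K :: "nat list set" and \<rho> :: "nat list \<Rightarrow> 'i \<times> 'a \<times> 'l"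
  assumes structure_rees: "prefix_automatic_structure (semigroup_graph (rees_carrier S I \<Lambda> F G))
    (rees_mult mult P) Y K \<rho>"
begin

sublocale rees: prefix_automatic_semigroup "rees_carrier S I \<Lambda> F G" "rees_mult mult P" Y K \<rho>
  using semigroupoid_rees structure_rees by (rule prefix_automatic_semigroup.intro)

definition row :: "nat \<Rightarrow> 'i" where "row a = fst (\<rho> [a])"
definition entry :: "nat \<Rightarrow> 'a" where "entry a = fst (snd (\<rho> [a]))"
definition col :: "nat \<Rightarrow> 'l" where "col a = snd (snd (\<rho> [a]))"

lemma rho_generator: "\<rho> [a] = (row a, entry a, col a)"
  by (simp add: row_def entry_def col_def)

lemma generator:
  assumes "a \<in> arcs Y"
  shows "row a \<in> I" "col a \<in> \<Lambda>" "entry a \<in> arcs S"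
    "tail S (entry a) = F (row a)" "head S (entry a) = G (col a)"
  using rees.rho_in[of "[a]"] assms by (simp_all add: rees_carrier_def rho_generator)

lemma row_rho:
  assumes "w \<noteq> []" "set w \<subseteq> arcs Y"
  shows "fst (\<rho> w) = row (hd w)"
proof (cases w)
  case (Cons a q)
  show ?thesis
  proof (cases "q = []")
    case False
    then have "\<rho> w = rees_mult mult P (\<rho> [a]) (\<rho> q)"
      using rees.rho_append[of "[a]" q] assms Cons by simp
    then show ?thesis by (simp add: rees_mult_def row_def Cons split: prod.splits)
  qed (simp add: Cons row_def)
qed (use assms in simp)

lemma col_rho:
  assumes "w \<noteq> []" "set w \<subseteq> arcs Y"
  shows "snd (snd (\<rho> w)) = col (last w)"
proof (cases w rule: rev_cases)
  case (snoc q a)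
  show ?thesis
  proof (cases "q = []")
    case False
    then have "\<rho> w = rees_mult mult P (\<rho> q) (\<rho> [a])"
      using rees.rho_append[of q "[a]"] assms snoc by simp
    then show ?thesis by (simp add: rees_mult_def col_def snoc split: prod.splits)
  qed (simp add: snoc col_def)
qed (use assms in simp)

lemma ex_row: "x \<in> arcs S \<Longrightarrow> \<exists>i\<in>I. F i = tail S x"
  using F_surj by (metis imageE imageI)

lemma ex_col: "x \<in> arcs S \<Longrightarrow> \<exists>l\<in>\<Lambda>. G l = head S x"
  using G_surj by (metis imageE imageI)

text \<open>The row index of a product in \<open>M\<close> is that of its first factor. Each
  \<open>i\<close> occurs as a row index in \<open>M\<close>, hence as that of one of the finitely
  many generators.\<close>

lemma finite_I: "finite I"
proof (rule finite_subset)
  show "I \<subseteq> row ` arcs Y"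
  proof
    fix i assume i: "i \<in> I"
    then obtain x where x: "x \<in> arcs S" "F i = tail S x" using F_surj by (metis imageE imageI)
    with ex_col obtain l where "l \<in> \<Lambda>" "G l = head S x" by blast
    with i x have "(i, x, l) \<in> rees_carrier S I \<Lambda> F G" by (simp add: rees_carrier_def)
    then obtain w where w: "w \<in> K" "\<rho> w = (i, x, l)" using rees.rho_K by (metis imageE)
    with rees.K_paths row_rho[of w] have "i = row (hd w)" "hd w \<in> arcs Y"
      by (fastforce, meson hd_in_set subsetD)
    then show "i \<in> row ` arcs Y" by blast
  qed
qed (simp add: rees.finite_arcs_Y)

lemma finite_Lambda: "finite \<Lambda>"
proof (rule finite_subset)
  show "\<Lambda> \<subseteq> col ` arcs Y"
  proof
    fix l assume l: "l \<in> \<Lambda>"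
    then obtain x where x: "x \<in> arcs S" "G l = head S x" using G_surj by (metis imageE imageI)
    with ex_row obtain i where "i \<in> I" "F i = tail S x" by blast
    with l x have "(i, x, l) \<in> rees_carrier S I \<Lambda> F G" by (simp add: rees_carrier_def)
    then obtain w where w: "w \<in> K" "\<rho> w = (i, x, l)" using rees.rho_K by (metis imageE)
    with rees.K_paths col_rho[of w] have "l = col (last w)" "last w \<in> arcs Y"
      by (fastforce, meson last_in_set subsetD)
    then show "l \<in> col ` arcs Y" by blast
  qed
qed (simp add: rees.finite_arcs_Y)

text \<open>Every object is a source or target of an arrow, and both kinds are indexed by finite
  sets. The padding alphabet has a dollar for each object, so its finiteness rests on this.\<close>

lemma finite_verts_S: "finite (verts S)"
proof (rule finite_subset)
  show "verts S \<subseteq> F ` I \<union> G ` \<Lambda>"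
    using isolation_free unfolding isolation_free_def F_surj G_surj by (intro subsetI) (metis UnCI imageI)
qed (simp add: finite_I finite_Lambda)

definition row0 :: "'o \<Rightarrow> 'i" where "row0 v = (SOME i. i \<in> I \<and> F i = v)"
definition col0 :: "'o \<Rightarrow> 'l" where "col0 v = (SOME l. l \<in> \<Lambda> \<and> G l = v)"

lemma row0: "x \<in> arcs S \<Longrightarrow> row0 (tail S x) \<in> I \<and> F (row0 (tail S x)) = tail S x"
  unfolding row0_def by (rule someI_ex) (use ex_row in blast)

lemma col0: "x \<in> arcs S \<Longrightarrow> col0 (head S x) \<in> \<Lambda> \<and> G (col0 (head S x)) = head S x"
  unfolding col0_def by (rule someI_ex) (use ex_col in blast)

end

text \<open>
  An edge of the new graph is a generator of the Rees matrix semigroup together with the row index of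
  the generator that follows it in a word, or \<^const>\<open>None\<close> at the end of the word. The sandwich
  matrix entry between two generators can thus be absorbed into the value of the first one, which
  keeps the lengths of words unchanged. The function \<open>c\<close> names these edges by natural numbers.
\<close>

locale coded_prefix_automatic_rees = prefix_automatic_rees S mult I \<Lambda> F G P Y K \<rho>
  for S :: "('o, 'a) pre_digraph" and mult (infixl \<open>\<cdot>\<close> 70)
    and I :: "'i set" and \<Lambda> :: "'l set" and F G P Y K \<rho> +
  fixes c :: "nat \<Rightarrow> nat \<times> 'i option" and N :: nat
  assumes code: "bij_betw c {..<N} (arcs Y \<times> insert None (Some ` I))"
begin

section \<open>The generating graph of the base semigroupoid and the evaluation of its paths\<close>

definition letter :: "nat \<Rightarrow> nat" where "letter n = fst (c n)"
definition next_row :: "nat \<Rightarrow> 'i option" where "next_row n = snd (c n)"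

lemma letter_in: "n < N \<Longrightarrow> letter n \<in> arcs Y"
  using bij_betwE[OF code] by (force simp: letter_def)

lemma next_row_in: "n < N \<Longrightarrow> next_row n = Some j \<Longrightarrow> j \<in> I"
  using bij_betwE[OF code] by (force simp: next_row_def)

lemma ex_code:
  assumes "a \<in> arcs Y" "r \<in> insert None (Some ` I)"
  shows "\<exists>n<N. letter n = a \<and> next_row n = r"
proof -
  have "(a, r) \<in> c ` {..<N}" using code assms by (simp add: bij_betw_def)
  then show ?thesis by (auto simp: letter_def next_row_def) (metis fst_conv snd_conv)
qed

definition val :: "nat \<Rightarrow> 'a" where
  "val n = (case next_row n of None \<Rightarrow> entry (letter n)
    | Some j \<Rightarrow> entry (letter n) \<cdot> P (col (letter n)) j)"

lemma val_arc:
  assumes "n < N"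
  shows "val n \<in> arcs S" "tail S (val n) = F (row (letter n))"
    "head S (val n) = (case next_row n of None \<Rightarrow> G (col (letter n)) | Some j \<Rightarrow> F j)"
  using generator[OF letter_in[OF assms]] next_row_in[OF assms]
  by (simp_all add: val_def mult_closed tail_mult head_mult P_arc tail_P head_P split: option.splits)

definition X :: "('o, nat) pre_digraph" where
  "X = \<lparr>verts = verts S, arcs = {..<N}, tail = \<lambda>n. tail S (val n), head = \<lambda>n. head S (val n)\<rparr>"

lemma X_simps [simp]:
  "verts X = verts S" "arcs X = {..<N}" "tail X n = tail S (val n)" "head X n = head S (val n)"
  by (simp_all add: X_def)

lemma wf_digraph_X: "wf_digraph X"
  by unfold_locales (simp_all add: val_arc(1))

lemma paths_X:
  "p \<in> paths X \<longleftrightarrow> p \<noteq> [] \<and> set p \<subseteq> {..<N} \<and>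
     successively (\<lambda>m n. head S (val m) = tail S (val n)) p"
  unfolding paths_conv_successively[OF wf_digraph_X] by simp

lemma path_induct [consumes 1, case_names single Cons]:
  assumes "p \<in> paths X"
    and "\<And>n. n < N \<Longrightarrow> Q [n]"
    and "\<And>n p. n < N \<Longrightarrow> p \<in> paths X \<Longrightarrow> head S (val n) = tail S (val (hd p)) \<Longrightarrow> Q p \<Longrightarrow> Q (n # p)"
  shows "Q p"
proof -
  have "p \<noteq> []" using assms(1) by (simp add: paths_X)
  then show ?thesis using assms(1)
  proof (induction p rule: list_nonempty_induct)
    case (single n)
    then show ?case using assms(2) by (simp add: paths_X)
  next
    case (cons n p)
    then have "n < N" "p \<in> paths X" "head S (val n) = tail S (val (hd p))"
      unfolding paths_X successively_Cons by simp_all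
    then show ?case using assms(3) cons.IH by blast
  qed
qed

definition act :: "nat list \<Rightarrow> 'a \<Rightarrow> 'a" where
  "act = foldr (\<lambda>n. (\<cdot>) (val n))"

text \<open>Singles out the last letter: putting another arrow \<open>z\<close> in its place gives
  \<open>act (butlast p) z\<close>, even if \<open>z\<close> is not the value of an edge.\<close>

definition eval :: "nat list \<Rightarrow> 'a" where
  "eval p = act (butlast p) (val (last p))"

lemma act_simps [simp]: "act [] z = z" "act (n # p) z = val n \<cdot> act p z"
  by (simp_all add: act_def)

lemma eval_simps [simp]: "eval [n] = val n" "p \<noteq> [] \<Longrightarrow> eval (n # p) = val n \<cdot> eval p"
  by (simp_all add: eval_def)

lemma eval_arc:
  assumes "p \<in> paths X"
  shows "eval p \<in> arcs S \<and> tail S (eval p) = tail S (val (hd p)) \<and> head S (eval p) = head S (val (last p))"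
  using assms
proof (induction p rule: path_induct)
  case (Cons n p)
  moreover from Cons have "p \<noteq> []" by (simp add: paths_X)
  ultimately show ?case by (simp add: val_arc(1) mult_closed tail_mult head_mult)
qed (simp add: val_arc(1))

lemma act_eq:
  assumes "p \<in> paths X" "z \<in> arcs S" "head S (val (last p)) = tail S z"
  shows "act p z = eval p \<cdot> z"
  using assms
proof (induction p rule: path_induct)
  case (Cons n p)
  then have "p \<noteq> []" by (simp add: paths_X)
  with Cons show ?case
    using mult_assoc[of "val n" "eval p" z] eval_arc[of p] by (simp add: val_arc(1))
qed simp

lemma eval_append:
  assumes "p \<in> paths X" "q \<in> paths X" "head S (val (last p)) = tail S (val (hd q))"
  shows "eval (p @ q) = eval p \<cdot> eval q"
proof -
  have "q \<noteq> []" using assms(2) by (simp add: paths_X)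
  then have "eval (p @ q) = act p (eval q)" by (simp add: eval_def butlast_append act_def)
  then show ?thesis using act_eq[OF assms(1)] eval_arc[OF assms(2)] assms(3) by simp
qed

lemma path_butlast:
  assumes "p \<in> paths X" "butlast p \<noteq> []"
  shows "butlast p \<in> paths X" "head S (val (last (butlast p))) = tail S (val (last p))"
proof -
  have "p = butlast p @ [last p]" using assms(1) by (simp add: paths_X)
  then have "butlast p @ [last p] \<in> paths X" using assms(1) by simp
  with assms(2) show "butlast p \<in> paths X" "head S (val (last (butlast p))) = tail S (val (last p))"
    unfolding paths_X successively_append_iff by simp_all
qed

lemma act_butlast_arc:
  assumes "p \<in> paths X" "z \<in> arcs S" "tail S z = tail S (val (last p))"
  shows "act (butlast p) z \<in> arcs S \<and> tail S (act (butlast p) z) = tail S (val (hd p)) \<and>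
    head S (act (butlast p) z) = head S z"
proof (cases "butlast p = []")
  case True
  have "p \<noteq> []" using assms(1) by (simp add: paths_X)
  with True have "hd p = last p" by (metis append_butlast_last_id append_Nil list.sel(1))
  with True assms show ?thesis by simp
next
  case False
  have "p \<noteq> []" using assms(1) by (simp add: paths_X)
  with False have "hd (butlast p) = hd p" by (metis append_butlast_last_id hd_append2)
  with path_butlast[OF assms(1) False] eval_arc[of "butlast p"] assms(2,3) show ?thesis
    by (simp add: act_eq mult_closed tail_mult head_mult)
qed

section \<open>Representatives for the base semigroupoid\<close>

definition linked :: "nat \<Rightarrow> nat \<Rightarrow> bool" where
  "linked m n \<longleftrightarrow> next_row m = Some (row (letter n))"

text \<open>A selected index is recognised by being fixed under selection at its own object. This
  and \<open>ending\<close> are conditions on single letters and so fit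
  \<open>finite_residuals_local\<close>.\<close>

definition starting :: "nat \<Rightarrow> bool" where
  "starting n \<longleftrightarrow> row0 (F (row (letter n))) = row (letter n)"

definition ending :: "nat \<Rightarrow> bool" where
  "ending n \<longleftrightarrow> next_row n = None \<and> col0 (G (col (letter n))) = col (letter n)"

text \<open>A local language cut with the preimage of \<open>K\<close> under a letter-to-letter map,
  so that regularity is inherited from \<open>K\<close>.\<close>

definition KS :: "nat list set" where
  "KS = {x. x \<noteq> [] \<and> set x \<subseteq> {..<N} \<and> starting (hd x) \<and> successively linked x \<and> ending (last x)} \<inter>
    {x. map letter x \<in> K}"

text \<open>Linking compares row indices, composability only their objects under
  \<open>F\<close>.\<close>

lemma linked_path:
  assumes "x \<noteq> []" "set x \<subseteq> {..<N}" "successively linked x"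
  shows "x \<in> paths X"
proof -
  have "successively (\<lambda>m n. head S (val m) = tail S (val n)) x"
    using assms(3)
  proof (rule successively_mono)
    fix m n assume "m \<in> set x" "n \<in> set x" "linked m n"
    moreover from this have "m < N" "n < N" using assms(2) by auto
    ultimately show "head S (val m) = tail S (val n)" by (simp add: val_arc linked_def)
  qed
  with assms show ?thesis by (simp add: paths_X)
qed

text \<open>The entry of \<open>P\<close> that \<open>rees_mult\<close> inserts between two linked
  letters is the factor that \<open>val\<close> has absorbed into the first one, with the same
  bracketing. The last letter is left open as \<open>z\<close>, since in a prefix its value may
  contain an entry that its generator lacks.\<close>

lemma act_map_letter:
  assumes "p \<noteq> []" "successively linked p"
  shows "rees.act (butlast (map letter p)) (row (letter (last p)), z, l) =
    (row (letter (hd p)), act (butlast p) z, l)"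
  using assms
proof (induction p rule: list_nonempty_induct)
  case (cons n p)
  then have link: "linked n (hd p)" "successively linked p" by (simp_all add: successively_Cons)
  have "rees.act (butlast (map letter (n # p))) t =
      rees_mult mult P (\<rho> [letter n]) (rees.act (butlast (map letter p)) t)" for t
    using cons.hyps by simp
  moreover have "butlast (n # p) = n # butlast p" "last (n # p) = last p" using cons.hyps by simp_all
  ultimately show ?case
    using link cons.IH
    by (simp add: rho_generator rees_mult_def[of _ P] linked_def val_def del: butlast.simps list.map last.simps)
qed simp

lemma rho_map_letter:
  assumes "x \<noteq> []" "set x \<subseteq> {..<N}" "successively linked x" "next_row (last x) = None"
  shows "\<rho> (map letter x) = (row (letter (hd x)), eval x, col (letter (last x)))"
proof -
  have "set (map letter x) \<subseteq> arcs Y" using assms(2) letter_in by auto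
  then have "\<rho> (map letter x) = rees.act (butlast (map letter x)) (\<rho> [letter (last x)])"
    using rees.rho_eq_act[of "map letter x"] assms(1) by (simp add: last_map)
  also have "\<rho> [letter (last x)] = (row (letter (last x)), val (last x), col (letter (last x)))"
    using assms(4) by (simp add: rho_generator val_def)
  finally show ?thesis using act_map_letter assms by (simp add: eval_def)
qed

text \<open>Row labels are filled in from the right: the final letter gets \<open>None\<close>,
  every earlier one the row of its successor.\<close>

lemma ex_lift:
  assumes "w \<noteq> []" "set w \<subseteq> arcs Y"
  shows "\<exists>x. x \<noteq> [] \<and> set x \<subseteq> {..<N} \<and> successively linked x \<and> next_row (last x) = None \<and>
    map letter x = w"
  using assms
proof (induction w rule: list_nonempty_induct)
  case (single a)
  then obtain n where "n < N" "letter n = a" "next_row n = None" using ex_code[of a None] by auto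
  then show ?case by (intro exI[of _ "[n]"]) simp
next
  case (cons a w)
  then obtain x where x: "x \<noteq> []" "set x \<subseteq> {..<N}" "successively linked x"
    "next_row (last x) = None" "map letter x = w" by auto
  have "row (letter (hd x)) \<in> I" using x(1,2) generator(1) letter_in by (metis hd_in_set lessThan_iff subsetD)
  then obtain n where "n < N" "letter n = a" "next_row n = Some (row (letter (hd x)))"
    using ex_code[of a "Some (row (letter (hd x)))"] cons.prems by auto
  with x show ?case by (intro exI[of _ "n # x"]) (simp add: successively_Cons linked_def)
qed

lemma KS_D:
  assumes "x \<in> KS"
  shows "x \<in> paths X" "map letter x \<in> K" "starting (hd x)" "ending (last x)"
    "\<rho> (map letter x) = (row (letter (hd x)), eval x, col (letter (last x)))"
  using assms linked_path rho_map_letter by (auto simp: KS_def ending_def)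

lemma eval_KS: "eval ` KS = arcs S"
proof
  show "eval ` KS \<subseteq> arcs S" using KS_D(1) eval_arc by blast
  show "arcs S \<subseteq> eval ` KS"
  proof
    fix z assume z: "z \<in> arcs S"
    \<comment> \<open>Among the triples with middle component \<open>z\<close>, the one with the
      selected indices has a lift that satisfies \<open>starting\<close> and
      \<open>ending\<close>.\<close>
    with row0 col0 have "(row0 (tail S z), z, col0 (head S z)) \<in> rees_carrier S I \<Lambda> F G"
      by (simp add: rees_carrier_def)
    then obtain w where w: "w \<in> K" "\<rho> w = (row0 (tail S z), z, col0 (head S z))"
      using rees.rho_K by (metis imageE)
    then obtain x where x: "x \<noteq> []" "set x \<subseteq> {..<N}" "successively linked x"
      "next_row (last x) = None" "map letter x = w"
      using ex_lift rees.K_paths by metis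
    have "(row (letter (hd x)), eval x, col (letter (last x))) =
        (row0 (tail S z), z, col0 (head S z))"
      using rho_map_letter[OF x(1-4)] unfolding x(5) w(2) by (rule sym)
    then have eq: "row (letter (hd x)) = row0 (tail S z)" "eval x = z"
      "col (letter (last x)) = col0 (head S z)" by (simp_all only: prod.inject)
    then have "x \<in> KS"
      using row0[OF z] col0[OF z] x w(1) by (simp add: KS_def starting_def ending_def)
    with eq(2) show "z \<in> eval ` KS" by blast
  qed
qed

lemma finite_residuals_KS: "finite_residuals KS"
  unfolding KS_def
  by (intro finite_residuals_Int finite_residuals_local finite_residuals_vimage_map
      rees.finite_residuals_K finite_lessThan)

text \<open>A prefix may lose \<open>ending\<close>: its last letter can still carry a row
  index.\<close>

lemma Pref_KS_D:
  assumes "p \<in> Pref KS"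
  shows "p \<in> paths X" "map letter p \<in> Pref K" "starting (hd p)" "successively linked p"
proof -
  obtain s where p: "p \<noteq> []" "p @ s \<in> KS" using assms by (auto simp: Pref_def prefix_def)
  then show *: "successively linked p" "starting (hd p)"
    by (simp_all add: KS_def successively_append_iff)
  show "p \<in> paths X" using p * by (intro linked_path) (simp_all add: KS_def)
  have "map letter p @ map letter s \<in> K" using p by (simp add: KS_def)
  then show "map letter p \<in> Pref K" using p(1) by (auto simp: Pref_def prefix_def)
qed

lemma KS_subset_Pref: "KS \<subseteq> Pref KS"
  by (auto simp: Pref_def KS_def)

text \<open>Once the arrows agree, so do the outer indices: the sources are equal and both paths
  start with selected rows, and the last column of \<open>x\<close> is the one selected at the
  target of \<open>z\<close>.\<close>

lemma eval_eq_act_iff: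
  assumes "x \<in> KS" "p \<in> Pref KS" "z \<in> arcs S" "tail S z = tail S (val (last p))"
  shows "\<rho> (map letter x) =
      rees.act (butlast (map letter p)) (row (letter (last p)), z, col0 (head S z)) \<longleftrightarrow>
    eval x = act (butlast p) z"
proof -
  note x = KS_D[OF assms(1)] and p = Pref_KS_D[OF assms(2)]
  have ne: "x \<noteq> []" "p \<noteq> []" and sub: "set x \<subseteq> {..<N}" "set p \<subseteq> {..<N}"
    using x(1) p(1) by (simp_all add: paths_X)
  then have N: "hd x < N" "last x < N" "hd p < N"
    by (meson hd_in_set last_in_set lessThan_iff subsetD)+
  have eq: "\<rho> (map letter x) =
        rees.act (butlast (map letter p)) (row (letter (last p)), z, col0 (head S z)) \<longleftrightarrow>
      row (letter (hd x)) = row (letter (hd p)) \<and> eval x = act (butlast p) z \<and>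
      col (letter (last x)) = col0 (head S z)"
    unfolding x(5) act_map_letter[OF ne(2) p(4)] by simp
  have "row (letter (hd x)) = row (letter (hd p))" "col (letter (last x)) = col0 (head S z)"
    if "eval x = act (butlast p) z"
  proof -
    have "tail S (val (hd x)) = tail S (val (hd p))" "head S (val (last x)) = head S z"
      using that eval_arc[OF x(1)] act_butlast_arc[OF p(1) assms(3,4)] by simp_all
    then have F: "F (row (letter (hd x))) = F (row (letter (hd p)))"
      and G: "G (col (letter (last x))) = head S z"
      using val_arc(2)[OF N(1)] val_arc(2)[OF N(3)] val_arc(3)[OF N(2)] x(4)
      by (simp_all add: ending_def)
    from F x(3) p(3) show "row (letter (hd x)) = row (letter (hd p))" by (simp add: starting_def)
    from G x(4) show "col (letter (last x)) = col0 (head S z)" by (simp add: ending_def)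
  qed
  then show ?thesis unfolding eq by blast
qed

text \<open>All the relations of the new structure are unions of relations of this form or of their converses.\<close>

definition value_relation :: "nat \<Rightarrow> 'a \<Rightarrow> (nat list \<times> nat list) set" where
  "value_relation n z = {(x, p) \<in> KS \<times> Pref KS. last p = n \<and> eval x = act (butlast p) z}"

text \<open>\<open>eval_eq_act_iff\<close> reduces this to a preimage of the relation in
  \<open>rees.finite_rel_residuals_act\<close>. The condition on the last letter is imposed once
  more because \<open>letter\<close> forgets the row index that follows.\<close>

lemma finite_rel_residuals_value_relation:
  assumes "n < N" "z \<in> arcs S" "tail S z = tail S (val n)"
  shows "finite_rel_residuals (value_relation n z)"
proof -
  let ?t = "(row (letter n), z, col0 (head S z))"
  let ?R = "{(u, p). u \<in> K \<and> p \<in> Pref K \<and> last p = letter n \<and> \<rho> u = rees.act (butlast p) ?t}"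
  have t: "?t \<in> rees_carrier S I \<Lambda> F G"
    using assms val_arc(2)[OF assms(1)] generator(1)[OF letter_in[OF assms(1)]] col0[OF assms(2)]
    by (simp add: rees_carrier_def)
  have "(x, p) \<in> value_relation n z \<longleftrightarrow>
      (x, p) \<in> {(x, p). (map letter x, map letter p) \<in> ?R} \<inter> KS \<times> (Pref KS \<inter> {p. p \<noteq> [] \<and> last p = n})"
    for x p
  proof (cases "x \<in> KS \<and> p \<in> Pref KS \<and> last p = n")
    case True
    then have "p \<noteq> []" using Pref_KS_D(1) by (auto simp: paths_X)
    then show ?thesis
      using True KS_D(2)[of x] Pref_KS_D(2)[of p] eval_eq_act_iff[of x p z] assms
      by (simp add: value_relation_def last_map)
  qed (auto simp: value_relation_def)
  then have eq: "value_relation n z =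
      {(x, p). (map letter x, map letter p) \<in> ?R} \<inter> KS \<times> (Pref KS \<inter> {p. p \<noteq> [] \<and> last p = n})"
    by (intro set_eqI) (simp only: split_paired_all)
  show ?thesis
    unfolding eq
    by (intro finite_rel_residuals_Int finite_rel_residuals_vimage_map finite_rel_residuals_Times
        rees.finite_rel_residuals_act t letter_in assms(1) finite_residuals_KS finite_residuals_Int
        finite_residuals_Pref finite_residuals_last)
qed

section \<open>Verification of the prefix-automatic structure\<close>

lemma synchronously_regular_X:
  "R \<subseteq> paths X \<times> paths X \<Longrightarrow> finite_rel_residuals R \<Longrightarrow> synchronously_regular X R"
  using synchronously_regular_if_finite_rel_residuals[OF wf_digraph_X] finite_verts_S by simp

lemma last_less: "p \<in> paths X \<Longrightarrow> last p < N"
  unfolding paths_X by (meson last_in_set lessThan_iff subsetD)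

lemma representatives: "choice_of_representatives S mult X KS eval"
proof -
  have "object_fixing_morphism (path_graph X) (@) S mult eval"
    using eval_arc eval_append by (simp add: object_fixing_morphism_def path_graph_def)
  moreover have "eval ` paths X = arcs S"
    using eval_arc eval_KS KS_D(1) by blast
  ultimately show ?thesis
    using wf_digraph_X KS_D(1) eval_KS by (auto simp: choice_of_representatives_def)
qed

text \<open>Appending \<open>e\<close> amounts to replacing the value of the last letter
  \<open>n\<close> of \<open>u\<close> by \<open>val n \<cdot> val e\<close>. Here \<open>u\<close>
  acts as the prefix and \<open>v\<close> as the representative, whence the converse.\<close>

lemma synchronously_regular_edge_relation:
  assumes "e \<in> arcs X"
  shows "synchronously_regular X (edge_relation X KS eval e)"
proof (rule synchronously_regular_X)
  let ?C = "{n \<in> {..<N}. head S (val n) = tail S (val e)}"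
  have "(u, v) \<in> edge_relation X KS eval e \<longleftrightarrow>
      (u, v) \<in> (\<Union>n\<in>?C. (value_relation n (val n \<cdot> val e))\<inverse>) \<inter> KS \<times> KS" for u v
  proof (cases "u \<in> KS \<and> v \<in> KS \<and> head S (val (last u)) = tail S (val e)")
    case True
    then have "u \<in> paths X" using KS_D(1) by blast
    then have u: "u \<noteq> []" "last u < N" using last_less by (auto simp: paths_X)
    have "eval (u @ [e]) = act (butlast u @ [last u]) (val e)"
      using u by (simp add: eval_def butlast_append)
    then have "eval (u @ [e]) = act (butlast u) (val (last u) \<cdot> val e)" by (simp add: act_def)
    with True u show ?thesis
      using KS_subset_Pref by (auto simp: edge_relation_def value_relation_def)
  qed (auto simp: edge_relation_def value_relation_def)
  then have eq: "edge_relation X KS eval e =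
      (\<Union>n\<in>?C. (value_relation n (val n \<cdot> val e))\<inverse>) \<inter> KS \<times> KS"
    by (intro set_eqI) (simp only: split_paired_all)
  show "finite_rel_residuals (edge_relation X KS eval e)"
    unfolding eq
    by (intro finite_rel_residuals_Int finite_rel_residuals_UN finite_rel_residuals_converse
        finite_rel_residuals_value_relation finite_rel_residuals_Times finite_residuals_KS)
      (use assms in \<open>auto simp: val_arc(1) mult_closed tail_mult\<close>)
qed (use KS_D(1) in \<open>auto simp: edge_relation_def\<close>)

text \<open>With \<open>z = val n\<close> the last letter keeps its value, and the value relation
  becomes equality under \<open>eval\<close>.\<close>

lemma synchronously_regular_vertex_relation:
  "synchronously_regular X (vertex_relation X KS eval v)"
proof (rule synchronously_regular_X)
  let ?C = "{n \<in> {..<N}. head S (val n) = v}"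
  have "(x, y) \<in> vertex_relation X KS eval v \<longleftrightarrow>
      (x, y) \<in> (\<Union>n\<in>?C. (value_relation n (val n))\<inverse>) \<inter> KS \<times> KS" for x y
    using KS_subset_Pref last_less[OF KS_D(1)]
    by (auto simp: vertex_relation_def value_relation_def simp flip: eval_def)
  then have eq: "vertex_relation X KS eval v =
      (\<Union>n\<in>?C. (value_relation n (val n))\<inverse>) \<inter> KS \<times> KS"
    by (intro set_eqI) (simp only: split_paired_all)
  show "finite_rel_residuals (vertex_relation X KS eval v)"
    unfolding eq
    by (intro finite_rel_residuals_Int finite_rel_residuals_UN finite_rel_residuals_converse
        finite_rel_residuals_value_relation finite_rel_residuals_Times finite_residuals_KS)
      (auto simp: val_arc(1))
qed (use KS_D(1) in \<open>auto simp: vertex_relation_def\<close>)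

lemma synchronously_regular_prefix_relation:
  "synchronously_regular X {(u, v) \<in> KS \<times> Pref KS. eval u = eval v}"
proof (rule synchronously_regular_X)
  have "(x, p) \<in> {(u, v) \<in> KS \<times> Pref KS. eval u = eval v} \<longleftrightarrow>
      (x, p) \<in> (\<Union>n\<in>{..<N}. value_relation n (val n))" for x p
    using last_less[OF Pref_KS_D(1)] by (auto simp: value_relation_def eval_def[of p])
  then have eq: "{(u, v) \<in> KS \<times> Pref KS. eval u = eval v} =
      (\<Union>n\<in>{..<N}. value_relation n (val n))"
    by (intro set_eqI) (simp only: split_paired_all)
  show "finite_rel_residuals {(u, v) \<in> KS \<times> Pref KS. eval u = eval v}"
    unfolding eq
    by (intro finite_rel_residuals_UN finite_rel_residuals_value_relation)
      (auto simp: val_arc(1))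
qed (use KS_D(1) Pref_KS_D(1) in auto)

lemma prefix_automatic_structure_X: "prefix_automatic_structure S mult X KS eval"
  using representatives synchronously_regular_edge_relation synchronously_regular_vertex_relation
    synchronously_regular_prefix_relation
  by (simp add: prefix_automatic_structure_def automatic_structure_def)

end

theorem theorem6p4:
  fixes S :: "('o, 'a) pre_digraph" and mult :: "'a \<Rightarrow> 'a \<Rightarrow> 'a"
    and I :: "'i set" and \<Lambda> :: "'l set"
    and F :: "'i \<Rightarrow> 'o" and G :: "'l \<Rightarrow> 'o" and P :: "'l \<Rightarrow> 'i \<Rightarrow> 'a"
  assumes "rees_matrix_data S mult I \<Lambda> F G P"
    and "prefix_automatic (semigroup_graph (rees_carrier S I \<Lambda> F G)) (rees_mult mult P)"
  shows "prefix_automatic S mult"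
proof -
  obtain Y :: "(unit, nat) pre_digraph" and K \<rho> where
    "prefix_automatic_structure (semigroup_graph (rees_carrier S I \<Lambda> F G)) (rees_mult mult P) Y K \<rho>"
    using assms(2) unfolding prefix_automatic_def by blast
  with assms(1) interpret prefix_automatic_rees S mult I \<Lambda> F G P Y K \<rho>
    by (simp add: prefix_automatic_rees_def prefix_automatic_rees_axioms_def)
  have "finite (arcs Y \<times> insert None (Some ` I))"
    using finite_I rees.finite_arcs_Y by simp
  \<comment> \<open>\<open>prefix_automatic\<close> asks for natural numbers as edges, so the finite
    set of edges is enumerated.\<close>
  then obtain c where
    "bij_betw c {..<card (arcs Y \<times> insert None (Some ` I))} (arcs Y \<times> insert None (Some ` I))"
    using ex_bij_betw_nat_finite unfolding atLeast0LessThan by blast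
  then interpret coded_prefix_automatic_rees S mult I \<Lambda> F G P Y K \<rho> c
    "card (arcs Y \<times> insert None (Some ` I))"
    by unfold_locales
  show ?thesis
    unfolding prefix_automatic_def using prefix_automatic_structure_X by blast
qed

end
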